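(* Let $Y$ be a topological space with a subspace $X\subseteq Y$ such that neither $X$ nor $Y$ has any odd-dimensional integral homology, and let $\iota:X\hookrightarrow Y$ be the inclusion. For each $i$, suppose that $\{X_j:j\in J_i\}$ is a basis of $H_i(X,\mathbb C)$ and $\{Y_k:k\in K_i\}$ is a basis of $H_i(Y,\mathbb C)$. Let $c_{j,k}$ denote the coefficients in the expansion $\iota_*(X_j)=\sum_{k\in K_i}c_{j,k}Y_k$ for $j\in J_i$. Suppose that for each $i$ there is a subset $\mathcal I_i\subseteq K_i$ such that the (finite square) matrix $(c_{j,k})_{j\in J_i,\,k\in\mathcal I_i}$ is invertible. Then the classes $\{\iota^*(Y_k^* ):k\in\bigcup_i\mathcal I_i\}$ form a basis of the cohomology $H^*(X,\mathbb C)=\bigoplus_iH^i(X,\mathbb C)$, where $\iota^*:H^*(Y,\mathbb C)\to H^*(X,\mathbb C)$ is the induced map.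
   Context: For $k\in K_i$, $Y_k^*\in H^i(Y,\mathbb C)\cong\mathrm{Hom}(H_i(Y,\mathbb C),\mathbb C)$ (Universal Coefficient Theorem) denotes the dual class defined by $Y_k^*(Y_{k'})=\delta_{k,k'}$ for $k,k'\in K_i$. *)

theory Defs
  imports "HOL-Homology.Homology" Complex_Main
begin

text \<open>
  Complex vector spaces are encoded as HOL-Algebra module records with scalars in
  the type \<^typ>\<open>complex\<close>.  The record type inherits ring multiplication and unit
  from \<^typ>\<open>'b ring\<close>; these two fields play no role for a vector space and are
  left unspecified.
\<close>

type_synonym 'b cvec = "(complex, 'b) module"

section \<open>Linear algebra\<close>

definition linear_independent_family :: "'b cvec \<Rightarrow> 'i set \<Rightarrow> ('i \<Rightarrow> 'b) \<Rightarrow> bool" where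
  "linear_independent_family M S v \<longleftrightarrow>
     (\<forall>A a. finite A \<and> A \<subseteq> S \<and> (\<Oplus>\<^bsub>M\<^esub>s\<in>A. a s \<odot>\<^bsub>M\<^esub> v s) = \<zero>\<^bsub>M\<^esub> \<longrightarrow> (\<forall>s\<in>A. a s = 0))"

definition spanning_family :: "'b cvec \<Rightarrow> 'i set \<Rightarrow> ('i \<Rightarrow> 'b) \<Rightarrow> bool" where
  "spanning_family M S v \<longleftrightarrow>
     (\<forall>x\<in>carrier M. \<exists>A a. finite A \<and> A \<subseteq> S \<and> x = (\<Oplus>\<^bsub>M\<^esub>s\<in>A. a s \<odot>\<^bsub>M\<^esub> v s))"

text \<open>A basis is an indexed family; independence forces the indexing to be injective.\<close>

definition basis_family :: "'b cvec \<Rightarrow> 'i set \<Rightarrow> ('i \<Rightarrow> 'b) \<Rightarrow> bool" where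
  "basis_family M S v \<longleftrightarrow>
     v \<in> S \<rightarrow> carrier M \<and> linear_independent_family M S v \<and> spanning_family M S v"

text \<open>The subquotient \<open>Z / B\<close> of \<open>M\<close>, for subspaces \<open>B \<subseteq> Z\<close>.  Scaling a coset is
  the coset of the scaled representatives; the elementwise product would be wrong for the
  scalar \<open>0\<close>.\<close>

definition subquotient :: "'b cvec \<Rightarrow> 'b set \<Rightarrow> 'b set \<Rightarrow> 'b set cvec" where
  "subquotient M Z B =
     \<lparr>carrier = (\<lambda>z. B +>\<^bsub>M\<^esub> z) ` Z, mult = undefined, one = undefined,
      zero = B, add = (\<lambda>P Q. P <+>\<^bsub>M\<^esub> Q),
      smult = (\<lambda>a P. \<Union>z\<in>P. B +>\<^bsub>M\<^esub> (a \<odot>\<^bsub>M\<^esub> z))\<rparr>"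

text \<open>The map on cosets induced by \<open>h\<close>, with target cosets of the subspace \<open>B\<close> of \<open>N\<close>.\<close>

definition coset_map :: "'c cvec \<Rightarrow> 'c set \<Rightarrow> ('b \<Rightarrow> 'c) \<Rightarrow> 'b set \<Rightarrow> 'c set" where
  "coset_map N B h P = (\<Union>z\<in>P. B +>\<^bsub>N\<^esub> h z)"

definition linear_functionals :: "'b cvec \<Rightarrow> ('b \<Rightarrow> complex) set" where
  "linear_functionals M =
     {\<phi> \<in> extensional (carrier M).
        (\<forall>x\<in>carrier M. \<forall>y\<in>carrier M. \<phi> (x \<oplus>\<^bsub>M\<^esub> y) = \<phi> x + \<phi> y) \<and>
        (\<forall>a. \<forall>x\<in>carrier M. \<phi> (a \<odot>\<^bsub>M\<^esub> x) = a * \<phi> x)}"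

definition dual_space :: "'b cvec \<Rightarrow> ('b \<Rightarrow> complex) cvec" where
  "dual_space M =
     \<lparr>carrier = linear_functionals M, mult = undefined, one = undefined,
      zero = (\<lambda>x\<in>carrier M. 0), add = (\<lambda>\<phi> \<psi>. \<lambda>x\<in>carrier M. \<phi> x + \<psi> x),
      smult = (\<lambda>a \<phi>. \<lambda>x\<in>carrier M. a * \<phi> x)\<rparr>"

definition direct_sum :: "(nat \<Rightarrow> 'b cvec) \<Rightarrow> (nat \<Rightarrow> 'b) cvec" where
  "direct_sum M =
     \<lparr>carrier = {u. (\<forall>i. u i \<in> carrier (M i)) \<and> finite {i. u i \<noteq> \<zero>\<^bsub>M i\<^esub>}},
      mult = undefined, one = undefined,
      zero = (\<lambda>i. \<zero>\<^bsub>M i\<^esub>), add = (\<lambda>u v i. u i \<oplus>\<^bsub>M i\<^esub> v i),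
      smult = (\<lambda>a u i. a \<odot>\<^bsub>M i\<^esub> u i)\<rparr>"

definition direct_sum_inj :: "(nat \<Rightarrow> 'b cvec) \<Rightarrow> nat \<Rightarrow> 'b \<Rightarrow> nat \<Rightarrow> 'b" where
  "direct_sum_inj M i x = (\<lambda>j. if j = i then x else \<zero>\<^bsub>M j\<^esub>)"

definition invertible_matrix_on :: "'j set \<Rightarrow> 'k set \<Rightarrow> ('j \<Rightarrow> 'k \<Rightarrow> complex) \<Rightarrow> bool" where
  "invertible_matrix_on J K c \<longleftrightarrow>
     finite J \<and> finite K \<and> card J = card K \<and>
     (\<exists>d. (\<forall>j\<in>J. \<forall>j'\<in>J. (\<Sum>k\<in>K. c j k * d k j') = (if j = j' then 1 else 0)) \<and>
          (\<forall>k\<in>K. \<forall>k'\<in>K. (\<Sum>j\<in>J. d k j * c j k') = (if k = k' then 1 else 0)))"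

section \<open>Singular homology with complex coefficients\<close>

text \<open>
  The HOL-Homology development has integral coefficients only.  The chain complex below
  is its complexification, built on the same singular simplices and faces; the boundary and
  the induced maps are the linear extensions of \<^const>\<open>chain_boundary\<close> and \<^const>\<open>chain_map\<close>.
\<close>

type_synonym 'a cchain = "((nat \<Rightarrow> real) \<Rightarrow> 'a) \<Rightarrow>\<^sub>0 complex"

definition cchains :: "nat \<Rightarrow> 'a topology \<Rightarrow> 'a cchain cvec" where
  "cchains p X =
     \<lparr>carrier = {z. Poly_Mapping.keys z \<subseteq> singular_simplex_set p X},
      mult = undefined, one = undefined, zero = 0, add = (+),
      smult = (\<lambda>a z. Poly_Mapping.map ((*) a) z)\<rparr>"

definition cboundary :: "nat \<Rightarrow> 'a cchain \<Rightarrow> 'a cchain" where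
  "cboundary p z =
     (if p = 0 then 0
      else \<Sum>f\<in>Poly_Mapping.keys z. \<Sum>k\<le>p.
             Poly_Mapping.single (singular_face p k f) ((-1) ^ k * Poly_Mapping.lookup z f))"

definition cchain_map :: "nat \<Rightarrow> ('a \<Rightarrow> 'b) \<Rightarrow> 'a cchain \<Rightarrow> 'b cchain" where
  "cchain_map p g z =
     (\<Sum>f\<in>Poly_Mapping.keys z.
        Poly_Mapping.single (simplex_map p g f) (Poly_Mapping.lookup z f))"

definition ccycles :: "nat \<Rightarrow> 'a topology \<Rightarrow> 'a cchain set" where
  "ccycles p X = {z \<in> carrier (cchains p X). cboundary p z = 0}"

definition cboundaries :: "nat \<Rightarrow> 'a topology \<Rightarrow> 'a cchain set" where
  "cboundaries p X = cboundary (Suc p) ` carrier (cchains (Suc p) X)"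

definition chomology :: "nat \<Rightarrow> 'a topology \<Rightarrow> 'a cchain set cvec" where
  "chomology p X = subquotient (cchains p X) (ccycles p X) (cboundaries p X)"

definition chomology_map ::
    "nat \<Rightarrow> 'b topology \<Rightarrow> ('a \<Rightarrow> 'b) \<Rightarrow> 'a cchain set \<Rightarrow> 'b cchain set" where
  "chomology_map p Y g = coset_map (cchains p Y) (cboundaries p Y) (cchain_map p g)"

section \<open>Singular cohomology with complex coefficients\<close>

type_synonym 'a ccochain = "'a cchain \<Rightarrow> complex"

definition ccochains :: "nat \<Rightarrow> 'a topology \<Rightarrow> 'a ccochain cvec" where
  "ccochains p X = dual_space (cchains p X)"

definition ccoboundary :: "nat \<Rightarrow> 'a topology \<Rightarrow> 'a ccochain \<Rightarrow> 'a ccochain" where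
  "ccoboundary p X \<phi> = (\<lambda>z\<in>carrier (cchains (Suc p) X). \<phi> (cboundary (Suc p) z))"

definition ccochain_map :: "nat \<Rightarrow> 'a topology \<Rightarrow> ('a \<Rightarrow> 'b) \<Rightarrow> 'b ccochain \<Rightarrow> 'a ccochain" where
  "ccochain_map p X g \<phi> = (\<lambda>z\<in>carrier (cchains p X). \<phi> (cchain_map p g z))"

definition ccocycles :: "nat \<Rightarrow> 'a topology \<Rightarrow> 'a ccochain set" where
  "ccocycles p X =
     {\<phi> \<in> carrier (ccochains p X). ccoboundary p X \<phi> = \<zero>\<^bsub>ccochains (Suc p) X\<^esub>}"

definition ccoboundaries :: "nat \<Rightarrow> 'a topology \<Rightarrow> 'a ccochain set" where
  "ccoboundaries p X =
     (case p of 0 \<Rightarrow> {\<zero>\<^bsub>ccochains 0 X\<^esub>}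
      | Suc q \<Rightarrow> ccoboundary q X ` carrier (ccochains q X))"

definition ccohomology :: "nat \<Rightarrow> 'a topology \<Rightarrow> 'a ccochain set cvec" where
  "ccohomology p X = subquotient (ccochains p X) (ccocycles p X) (ccoboundaries p X)"

definition ccohomology_map ::
    "nat \<Rightarrow> 'a topology \<Rightarrow> ('a \<Rightarrow> 'b) \<Rightarrow> 'b ccochain set \<Rightarrow> 'a ccochain set" where
  "ccohomology_map p X g = coset_map (ccochains p X) (ccoboundaries p X) (ccochain_map p X g)"

definition total_ccohomology :: "'a topology \<Rightarrow> (nat \<Rightarrow> 'a ccochain set) cvec" where
  "total_ccohomology X = direct_sum (\<lambda>i. ccohomology i X)"

definition total_ccohomology_map ::
    "'a topology \<Rightarrow> ('a \<Rightarrow> 'b) \<Rightarrow> (nat \<Rightarrow> 'b ccochain set) \<Rightarrow> nat \<Rightarrow> 'a ccochain set" where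
  "total_ccohomology_map X g u = (\<lambda>i. ccohomology_map i X g (u i))"

text \<open>
  The evaluation pairing of a cohomology class with a homology class.  It does not
  depend on the chosen representatives, and \<open>\<alpha> \<mapsto> kronecker \<alpha>\<close> is the universal coefficient
  isomorphism from \<open>H\<^sup>i(X, C)\<close> to \<open>Hom(H\<^sub>i(X, C), C)\<close>.
\<close>

definition kronecker :: "'a ccochain set \<Rightarrow> 'a cchain set \<Rightarrow> complex" where
  "kronecker \<alpha> \<xi> = (THE w. \<exists>\<phi>\<in>\<alpha>. \<exists>z\<in>\<xi>. w = \<phi> z)"

text \<open>For \<open>k \<in> K\<close> and \<open>v\<close> a basis of the \<open>i\<close>-th homology indexed by \<open>K\<close>, the universal
  coefficient theorem guarantees exactly one such class.\<close>

definition dual_class ::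
    "nat \<Rightarrow> 'a topology \<Rightarrow> 'k set \<Rightarrow> ('k \<Rightarrow> 'a cchain set) \<Rightarrow> 'k \<Rightarrow> 'a ccochain set" where
  "dual_class i X K v k =
     (THE \<alpha>. \<alpha> \<in> carrier (ccohomology i X) \<and>
             (\<forall>k'\<in>K. kronecker \<alpha> (v k') = (if k = k' then 1 else 0)))"

end

theory Submission
  imports Defs
begin

text \<open>
  Evaluating cochains on chains gives a pairing between \<open>H\<^sup>i(X, C)\<close> and \<open>H\<^sub>i(X, C)\<close>, and for the
  inclusion \<open>\<iota>\<close> the projection formula turns the value of \<open>\<iota>\<^sup>* Y\<^sub>k\<^sup>*\<close> on \<open>X\<^sub>j\<close> into the value of \<open>Y\<^sub>k\<^sup>*\<close> on
  \<open>\<iota>\<^sub>* X\<^sub>j\<close>, which is the coefficient \<open>c\<^bsub>j,k\<^esub>\<close> (lemma \<open>kronecker_natural\<close>).  A class in \<open>H\<^sup>i(X, C)\<close> is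
  determined by its values on the basis \<open>X\<^sub>j\<close>.  So the classes \<open>\<iota>\<^sup>* Y\<^sub>k\<^sup>*\<close> are vectors whose matrix of
  coordinates with respect to a separating family of linear forms is invertible, and such vectors form
  a basis (lemma \<open>basis_family_if_invertible_pairing\<close>).  Putting the degrees together gives a basis
  of the direct sum (lemma \<open>basis_family_direct_sum\<close>).

  What has to be supplied from topology is the universal coefficient theorem over a field.  Its
  injectivity (lemma \<open>ccohomology_eqI\<close>) is used twice: for \<open>X\<close>, to know that the forms separate
  classes, and for \<open>Y\<close>, to know that the dual classes are unique.  Its surjectivity is used only in the
  form that a basis of homology has dual classes (lemma \<open>exists_dual_cohomology_class\<close>).  Both
  come from linear algebra in the space of chains: a right inverse of the boundary on its image for
  the first, and a functional separating a vector from a subspace for the second.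

  The identities \<open>\<partial>\<partial> = 0\<close> and \<open>\<partial>g\<^sub># = g\<^sub>#\<partial>\<close> for complex chains are reduced to the known ones for
  integral chains: both sides are complex linear, and they agree on single simplices.
\<close>

section \<open>Complex vector spaces as module records\<close>

text \<open>
  In place of the group axiom of inverses the locale asks for \<^term>\<open>0\<close> to act as zero: this is what
  is easy to check for cosets and for families, and it makes \<open>(-1) \<odot> x\<close> the inverse of \<open>x\<close>.
\<close>

locale complex_space = abelian_monoid M for M :: "'b cvec" (structure) +
  assumes smult_closed [simp, intro]: "x \<in> carrier M \<Longrightarrow> a \<odot> x \<in> carrier M"
    and smult_l_distr: "x \<in> carrier M \<Longrightarrow> (a + b) \<odot> x = a \<odot> x \<oplus> b \<odot> x"
    and smult_r_distr: "x \<in> carrier M \<Longrightarrow> y \<in> carrier M \<Longrightarrow> a \<odot> (x \<oplus> y) = a \<odot> x \<oplus> a \<odot> y"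
    and smult_assoc: "x \<in> carrier M \<Longrightarrow> (a * b) \<odot> x = a \<odot> (b \<odot> x)"
    and smult_one [simp]: "x \<in> carrier M \<Longrightarrow> 1 \<odot> x = x"
    and smult_zero_left [simp]: "x \<in> carrier M \<Longrightarrow> 0 \<odot> x = \<zero>"
begin

lemma add_smult_minus_one: "x \<in> carrier M \<Longrightarrow> x \<oplus> (-1) \<odot> x = \<zero>"
  using smult_l_distr[of x 1 "-1"] by simp

lemma smult_zero_right [simp]: "a \<odot> \<zero> = \<zero>"
  using smult_assoc[of "\<zero>" a 0] by simp

lemma abelian_group: "abelian_group M"
proof (rule abelian_groupI)
  show "\<exists>y\<in>carrier M. y \<oplus> x = \<zero>" if "x \<in> carrier M" for x
    using add_smult_minus_one[OF that] that by (metis a_comm smult_closed)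
qed (simp_all add: a_ac)

end

sublocale complex_space \<subseteq> abelian_group M
  by (rule abelian_group)

definition linear_subspace :: "'b cvec \<Rightarrow> 'b set \<Rightarrow> bool" where
  "linear_subspace M S \<longleftrightarrow>
     S \<subseteq> carrier M \<and> \<zero>\<^bsub>M\<^esub> \<in> S \<and> (\<forall>x\<in>S. \<forall>y\<in>S. x \<oplus>\<^bsub>M\<^esub> y \<in> S) \<and> (\<forall>a. \<forall>x\<in>S. a \<odot>\<^bsub>M\<^esub> x \<in> S)"

definition linear_map :: "'b cvec \<Rightarrow> 'c cvec \<Rightarrow> ('b \<Rightarrow> 'c) \<Rightarrow> bool" where
  "linear_map M N h \<longleftrightarrow>
     h \<in> carrier M \<rightarrow> carrier N \<and>
     (\<forall>x\<in>carrier M. \<forall>y\<in>carrier M. h (x \<oplus>\<^bsub>M\<^esub> y) = h x \<oplus>\<^bsub>N\<^esub> h y) \<and>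
     (\<forall>a. \<forall>x\<in>carrier M. h (a \<odot>\<^bsub>M\<^esub> x) = a \<odot>\<^bsub>N\<^esub> h x)"

definition linear_form :: "'b cvec \<Rightarrow> ('b \<Rightarrow> complex) \<Rightarrow> bool" where
  "linear_form M e \<longleftrightarrow>
     (\<forall>x\<in>carrier M. \<forall>y\<in>carrier M. e (x \<oplus>\<^bsub>M\<^esub> y) = e x + e y) \<and>
     (\<forall>a. \<forall>x\<in>carrier M. e (a \<odot>\<^bsub>M\<^esub> x) = a * e x)"

lemma linear_map_zero:
  assumes "complex_space M" "complex_space N" "linear_map M N h"
  shows "h \<zero>\<^bsub>M\<^esub> = \<zero>\<^bsub>N\<^esub>"
proof -
  interpret M: complex_space M by fact
  interpret N: complex_space N by fact
  have "h (0 \<odot>\<^bsub>M\<^esub> \<zero>\<^bsub>M\<^esub>) = 0 \<odot>\<^bsub>N\<^esub> h \<zero>\<^bsub>M\<^esub>" "h \<zero>\<^bsub>M\<^esub> \<in> carrier N"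
    using assms(3) M.zero_closed unfolding linear_map_def by blast+
  then show ?thesis by simp
qed

lemma linear_subspace_carrier:
  assumes "complex_space M"
  shows "linear_subspace M (carrier M)"
proof -
  interpret complex_space M by fact
  show ?thesis by (auto simp: linear_subspace_def)
qed

lemma linear_subspace_image:
  assumes "complex_space M" "complex_space N" "linear_map M N h"
  shows "linear_subspace N (h ` carrier M)"
proof -
  interpret M: complex_space M by fact
  interpret N: complex_space N by fact
  have "\<zero>\<^bsub>N\<^esub> \<in> h ` carrier M"
    using linear_map_zero[OF assms] by (metis M.zero_closed imageI)
  moreover have "h x \<oplus>\<^bsub>N\<^esub> h y \<in> h ` carrier M" if "x \<in> carrier M" "y \<in> carrier M" for x y
    using assms(3) that by (metis (no_types, lifting) M.a_closed imageI linear_map_def)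
  moreover have "a \<odot>\<^bsub>N\<^esub> h x \<in> h ` carrier M" if "x \<in> carrier M" for a x
    using assms(3) that by (metis (no_types, lifting) M.smult_closed imageI linear_map_def)
  ultimately show ?thesis
    using assms(3) by (auto simp: linear_subspace_def linear_map_def)
qed

lemma linear_subspace_kernel:
  assumes "complex_space M" "complex_space N" "linear_map M N h"
  shows "linear_subspace M {x \<in> carrier M. h x = \<zero>\<^bsub>N\<^esub>}"
proof -
  interpret M: complex_space M by fact
  interpret N: complex_space N by fact
  show ?thesis
    using assms(3) linear_map_zero[OF assms] by (auto simp: linear_subspace_def linear_map_def)
qed

lemma linear_form_zero:
  assumes "complex_space M" "linear_form M e"
  shows "e \<zero>\<^bsub>M\<^esub> = 0"
proof -
  interpret M: complex_space M by fact
  have "e (0 \<odot>\<^bsub>M\<^esub> \<zero>\<^bsub>M\<^esub>) = 0 * e \<zero>\<^bsub>M\<^esub>"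
    using assms(2) M.zero_closed unfolding linear_form_def by blast
  then show ?thesis by simp
qed

lemma linear_form_finsum:
  assumes "complex_space M" "linear_form M e" "finite A" "v \<in> A \<rightarrow> carrier M"
  shows "e (\<Oplus>\<^bsub>M\<^esub>s\<in>A. a s \<odot>\<^bsub>M\<^esub> v s) = (\<Sum>s\<in>A. a s * e (v s))"
proof -
  interpret M: complex_space M by fact
  show ?thesis using assms(3,4)
  proof (induction A rule: finite_induct)
    case empty
    then show ?case using linear_form_zero[OF assms(1,2)] by simp
  next
    case (insert x F)
    then have "(\<lambda>s. a s \<odot>\<^bsub>M\<^esub> v s) \<in> F \<rightarrow> carrier M" "a x \<odot>\<^bsub>M\<^esub> v x \<in> carrier M" "v x \<in> carrier M"
      by (auto simp: Pi_iff)
    with insert assms(2) show ?case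
      by (simp add: M.finsum_insert linear_form_def)
  qed
qed

section \<open>Bases\<close>

text \<open>
  The inverse matrix \<open>d\<close> does both halves.  Applying the forms to a linear relation between the \<open>w k\<close>
  gives a relation between the columns of \<open>c\<close>, and \<open>d\<close> cancels \<open>c\<close>.  Conversely \<open>d\<close> applied to
  the values \<open>e j x\<close> gives coefficients for which the combination of the \<open>w k\<close> takes the same values
  as \<open>x\<close>, and these values determine \<open>x\<close>.
\<close>
lemma basis_family_if_invertible_pairing:
  assumes "complex_space M"
    and w: "w \<in> I \<rightarrow> carrier M"
    and e: "\<And>j. j \<in> J \<Longrightarrow> linear_form M (e j)"
    and sep: "\<And>x y. \<lbrakk>x \<in> carrier M; y \<in> carrier M; \<And>j. j \<in> J \<Longrightarrow> e j x = e j y\<rbrakk> \<Longrightarrow> x = y"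
    and pairing: "\<And>j k. j \<in> J \<Longrightarrow> k \<in> I \<Longrightarrow> e j (w k) = c j k"
    and inv: "invertible_matrix_on J I c"
  shows "basis_family M I w"
proof -
  interpret M: complex_space M by fact
  obtain d where fin: "finite J" "finite I"
    and cd: "\<And>j j'. \<lbrakk>j \<in> J; j' \<in> J\<rbrakk> \<Longrightarrow> (\<Sum>k\<in>I. c j k * d k j') = (if j = j' then 1 else 0)"
    and dc: "\<And>k k'. \<lbrakk>k \<in> I; k' \<in> I\<rbrakk> \<Longrightarrow> (\<Sum>j\<in>J. d k j * c j k') = (if k = k' then 1 else 0)"
    using inv unfolding invertible_matrix_on_def by blast
  have ev: "e j (\<Oplus>\<^bsub>M\<^esub>k\<in>A. a k \<odot>\<^bsub>M\<^esub> w k) = (\<Sum>k\<in>A. a k * c j k)"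
    if "A \<subseteq> I" "j \<in> J" for A a j
  proof -
    have "e j (\<Oplus>\<^bsub>M\<^esub>k\<in>A. a k \<odot>\<^bsub>M\<^esub> w k) = (\<Sum>k\<in>A. a k * e j (w k))"
      by (rule linear_form_finsum[OF assms(1) e]) (use that w fin in \<open>auto intro: finite_subset\<close>)
    then show ?thesis using that pairing by (auto intro!: sum.cong)
  qed
  have "linear_independent_family M I w"
    unfolding linear_independent_family_def
  proof (intro allI impI ballI, elim conjE)
    fix A a k
    assume A: "A \<subseteq> I" and zero: "(\<Oplus>\<^bsub>M\<^esub>s\<in>A. a s \<odot>\<^bsub>M\<^esub> w s) = \<zero>\<^bsub>M\<^esub>" and k: "k \<in> A"
    have row: "(\<Sum>k'\<in>A. a k' * c j k') = 0" if "j \<in> J" for j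
      using ev[OF A that, of a] zero linear_form_zero[OF assms(1) e[OF that]] by simp
    have "0 = (\<Sum>j\<in>J. d k j * (\<Sum>k'\<in>A. a k' * c j k'))"
      using row by simp
    also have "\<dots> = (\<Sum>k'\<in>A. a k' * (\<Sum>j\<in>J. d k j * c j k'))"
      unfolding sum_distrib_left by (subst sum.swap) (simp add: mult_ac)
    also have "\<dots> = (\<Sum>k'\<in>A. if k = k' then a k' else 0)"
      using A k by (intro sum.cong) (auto simp: dc subset_iff)
    also have "\<dots> = a k"
      using k finite_subset[OF A fin(2)] by simp
    finally show "a k = 0" by simp
  qed
  moreover have "spanning_family M I w"
    unfolding spanning_family_def
  proof
    fix x assume x: "x \<in> carrier M"
    define a where "a k = (\<Sum>j\<in>J. d k j * e j x)" for k
    have "x = (\<Oplus>\<^bsub>M\<^esub>k\<in>I. a k \<odot>\<^bsub>M\<^esub> w k)"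
    proof (rule sep[OF x])
      show "(\<Oplus>\<^bsub>M\<^esub>k\<in>I. a k \<odot>\<^bsub>M\<^esub> w k) \<in> carrier M"
        using w by (intro M.finsum_closed) auto
      fix j assume j: "j \<in> J"
      have "e j (\<Oplus>\<^bsub>M\<^esub>k\<in>I. a k \<odot>\<^bsub>M\<^esub> w k) = (\<Sum>k\<in>I. a k * c j k)"
        using ev[OF subset_refl j] .
      also have "\<dots> = (\<Sum>j'\<in>J. (\<Sum>k\<in>I. c j k * d k j') * e j' x)"
        unfolding a_def sum_distrib_right by (subst sum.swap) (simp add: mult_ac)
      also have "\<dots> = (\<Sum>j'\<in>J. if j = j' then e j' x else 0)"
        using j by (intro sum.cong) (auto simp: cd)
      also have "\<dots> = e j x"
        using j fin by simp
      finally show "e j x = e j (\<Oplus>\<^bsub>M\<^esub>k\<in>I. a k \<odot>\<^bsub>M\<^esub> w k)" by simp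
    qed
    then show "\<exists>A a. finite A \<and> A \<subseteq> I \<and> x = (\<Oplus>\<^bsub>M\<^esub>s\<in>A. a s \<odot>\<^bsub>M\<^esub> w s)"
      using fin by blast
  qed
  ultimately show ?thesis
    using w by (simp add: basis_family_def)
qed

lemma linear_form_eq_on_spanning_family:
  assumes "complex_space M" "linear_form M e" "linear_form M e'"
    and "basis_family M S v" "\<And>s. s \<in> S \<Longrightarrow> e (v s) = e' (v s)" "x \<in> carrier M"
  shows "e x = e' x"
proof -
  obtain A a where A: "finite A" "A \<subseteq> S" and x: "x = (\<Oplus>\<^bsub>M\<^esub>s\<in>A. a s \<odot>\<^bsub>M\<^esub> v s)"
    using assms(4,6) unfolding basis_family_def spanning_family_def by blast
  have v: "v \<in> A \<rightarrow> carrier M"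
    using assms(4) A by (auto simp: basis_family_def)
  show ?thesis
    unfolding x linear_form_finsum[OF assms(1,2) A(1) v] linear_form_finsum[OF assms(1,3) A(1) v]
    using A assms(5) by (intro sum.cong) auto
qed

lemma complex_space_direct_sum:
  assumes "\<And>i. complex_space (M i)"
  shows "complex_space (direct_sum M)"
proof -
  interpret M: complex_space "M l" for l by (rule assms)
  have supp_add: "finite {i. u i \<oplus>\<^bsub>M i\<^esub> v i \<noteq> \<zero>\<^bsub>M i\<^esub>}"
    if "finite {i. u i \<noteq> \<zero>\<^bsub>M i\<^esub>}" "finite {i. v i \<noteq> \<zero>\<^bsub>M i\<^esub>}" for u v
    by (rule finite_subset[OF _ finite_UnI[OF that]]) auto
  have supp_smult: "finite {i. a \<odot>\<^bsub>M i\<^esub> u i \<noteq> \<zero>\<^bsub>M i\<^esub>}"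
    if "finite {i. u i \<noteq> \<zero>\<^bsub>M i\<^esub>}" for a u
    by (rule finite_subset[OF _ that]) auto
  show ?thesis
  proof (intro complex_space.intro abelian_monoidI complex_space_axioms.intro)
  qed (auto simp: direct_sum_def supp_add supp_smult M.a_ac
        M.smult_l_distr M.smult_r_distr M.smult_assoc)
qed

lemma direct_sum_simps:
  "\<zero>\<^bsub>direct_sum M\<^esub> i = \<zero>\<^bsub>M i\<^esub>"
  "(u \<oplus>\<^bsub>direct_sum M\<^esub> u') i = u i \<oplus>\<^bsub>M i\<^esub> u' i"
  "(a \<odot>\<^bsub>direct_sum M\<^esub> u) i = a \<odot>\<^bsub>M i\<^esub> u i"
  by (simp_all add: direct_sum_def)

lemma direct_sum_finsum:
  fixes M :: "nat \<Rightarrow> 'b cvec" and i :: nat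
  assumes "\<And>i. complex_space (M i)" "finite A" "f \<in> A \<rightarrow> carrier (direct_sum M)"
  shows "(\<Oplus>\<^bsub>direct_sum M\<^esub>s\<in>A. f s) i = (\<Oplus>\<^bsub>M i\<^esub>s\<in>A. f s i)"
proof -
  interpret M: complex_space "M l" for l by (rule assms)
  interpret D: complex_space "direct_sum M" by (rule complex_space_direct_sum[OF assms(1)])
  show ?thesis using assms(2,3)
  proof (induction A rule: finite_induct)
    case empty
    then show ?case by (simp add: direct_sum_simps)
  next
    case (insert x F)
    then have f: "f \<in> F \<rightarrow> carrier (direct_sum M)" "f x \<in> carrier (direct_sum M)"
      by auto
    then have fi: "(\<lambda>s. f s i) \<in> F \<rightarrow> carrier (M i)" "f x i \<in> carrier (M i)"
      by (auto simp: direct_sum_def)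
    show ?case
      unfolding D.finsum_insert[OF insert.hyps f] M.finsum_insert[OF insert.hyps fi]
      using insert.IH[OF f(1)] by (simp add: direct_sum_simps)
  qed
qed

text \<open>
  A finite combination in the direct sum has as its \<open>i\<close>-th component the combination of those terms
  that are indexed by pairs \<open>(i, s)\<close>; both halves are then the statement in each \<open>M i\<close>.
\<close>
lemma basis_family_direct_sum:
  assumes cs: "\<And>i. complex_space (M i)" and basis: "\<And>i. basis_family (M i) (S i) (v i)"
  shows "basis_family (direct_sum M) (SIGMA i:UNIV. S i) (\<lambda>(i, s). direct_sum_inj M i (v i s))"
    (is "basis_family ?D ?S ?w")
proof -
  interpret M: complex_space "M l" for l by (rule cs)
  interpret D: complex_space ?D by (rule complex_space_direct_sum[OF cs])
  have v: "v i s \<in> carrier (M i)" if "s \<in> S i" for i s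
    using basis[of i] that by (auto simp: basis_family_def)
  have w: "?w \<in> ?S \<rightarrow> carrier ?D"
    by (auto simp: direct_sum_def direct_sum_inj_def v)
  have component: "(\<Oplus>\<^bsub>?D\<^esub>p\<in>A. a p \<odot>\<^bsub>?D\<^esub> ?w p) i = (\<Oplus>\<^bsub>M i\<^esub>s\<in>A``{i}. a (i, s) \<odot>\<^bsub>M i\<^esub> v i s)"
    if A: "finite A" "A \<subseteq> ?S" for A a i
  proof -
    let ?f = "\<lambda>p. (a p \<odot>\<^bsub>?D\<^esub> ?w p) i"
    have wA: "(\<lambda>p. a p \<odot>\<^bsub>?D\<^esub> ?w p) \<in> A \<rightarrow> carrier ?D"
      using w A by blast
    have fM: "?f p \<in> carrier (M i)" if "p \<in> A" for p
      using funcset_mem[OF wA that] unfolding direct_sum_def by simp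
    have "(\<Oplus>\<^bsub>?D\<^esub>p\<in>A. a p \<odot>\<^bsub>?D\<^esub> ?w p) i = (\<Oplus>\<^bsub>M i\<^esub>p\<in>A. ?f p)"
      by (rule direct_sum_finsum[OF cs A(1) wA])
    also have "\<dots> = (\<Oplus>\<^bsub>M i\<^esub>p\<in>Pair i ` (A``{i}). ?f p)"
    proof (rule M.add.finprod_mono_neutral_cong_right)
      show "?f \<in> A \<rightarrow> carrier (M i)"
        using fM by blast
      show "Pair i ` (A``{i}) \<subseteq> A" by auto
      show "?f p = \<zero>\<^bsub>M i\<^esub>" if "p \<in> A - Pair i ` (A``{i})" for p
        using that by (cases p) (auto simp: direct_sum_def direct_sum_inj_def image_iff)
    qed (use A in auto)
    also have "\<dots> = (\<Oplus>\<^bsub>M i\<^esub>s\<in>A``{i}. ?f (i, s))"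
      by (rule M.finsum_reindex) (use fM in \<open>auto simp: inj_on_def\<close>)
    also have "\<dots> = (\<Oplus>\<^bsub>M i\<^esub>s\<in>A``{i}. a (i, s) \<odot>\<^bsub>M i\<^esub> v i s)"
      using A v by (intro M.finsum_cong') (auto simp: direct_sum_def direct_sum_inj_def)
    finally show ?thesis .
  qed
  have "linear_independent_family ?D ?S ?w"
    unfolding linear_independent_family_def
  proof (intro allI impI ballI, elim conjE)
    fix A a p
    assume A: "finite A" "A \<subseteq> ?S" and zero: "(\<Oplus>\<^bsub>?D\<^esub>p\<in>A. a p \<odot>\<^bsub>?D\<^esub> ?w p) = \<zero>\<^bsub>?D\<^esub>"
      and p: "p \<in> A"
    obtain i s where p_eq: "p = (i, s)" by (cases p)
    have "(\<Oplus>\<^bsub>M i\<^esub>s\<in>A``{i}. a (i, s) \<odot>\<^bsub>M i\<^esub> v i s) = \<zero>\<^bsub>M i\<^esub>"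
      using component[OF A, of a i] zero by (simp add: direct_sum_def)
    moreover have "finite (A``{i})" "A``{i} \<subseteq> S i" "s \<in> A``{i}"
      using A p p_eq by (auto intro: finite_Image)
    ultimately show "a p = 0"
      using basis[of i] p_eq unfolding basis_family_def linear_independent_family_def by metis
  qed
  moreover have "spanning_family ?D ?S ?w"
    unfolding spanning_family_def
  proof
    fix u assume u: "u \<in> carrier ?D"
    define F where "F = {i. u i \<noteq> \<zero>\<^bsub>M i\<^esub>}"
    have F: "finite F" and ui: "\<And>i. u i \<in> carrier (M i)"
      using u by (auto simp: direct_sum_def F_def)
    have "\<forall>i. \<exists>A a. finite A \<and> A \<subseteq> S i \<and> u i = (\<Oplus>\<^bsub>M i\<^esub>s\<in>A. a s \<odot>\<^bsub>M i\<^esub> v i s)"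
      using basis ui unfolding basis_family_def spanning_family_def by blast
    then obtain A a where A: "\<And>i. finite (A i)" "\<And>i. A i \<subseteq> S i"
      and ua: "\<And>i. u i = (\<Oplus>\<^bsub>M i\<^esub>s\<in>A i. a i s \<odot>\<^bsub>M i\<^esub> v i s)"
      by metis
    let ?A = "SIGMA i:F. A i" and ?a = "\<lambda>(i, s). a i s"
    have fA: "finite ?A" "?A \<subseteq> ?S"
      using A F by auto
    have "u = (\<Oplus>\<^bsub>?D\<^esub>p\<in>?A. ?a p \<odot>\<^bsub>?D\<^esub> ?w p)"
    proof
      fix i
      have "u i = (\<Oplus>\<^bsub>M i\<^esub>s\<in>?A``{i}. ?a (i, s) \<odot>\<^bsub>M i\<^esub> v i s)"
      proof (cases "i \<in> F")
        case True
        then have "?A``{i} = A i" by auto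
        then show ?thesis using ua[of i] by simp
      next
        case False
        then have "?A``{i} = {}" by auto
        then show ?thesis using False by (simp add: F_def)
      qed
      then show "u i = (\<Oplus>\<^bsub>?D\<^esub>p\<in>?A. ?a p \<odot>\<^bsub>?D\<^esub> ?w p) i"
        using component[OF fA, of ?a i] by simp
    qed
    then show "\<exists>A a. finite A \<and> A \<subseteq> ?S \<and> u = (\<Oplus>\<^bsub>?D\<^esub>p\<in>A. a p \<odot>\<^bsub>?D\<^esub> ?w p)"
      using fA by blast
  qed
  ultimately show ?thesis
    using w by (simp add: basis_family_def)
qed

section \<open>Subquotients\<close>

lemma linear_subspace_imp_abelian_subgroup:
  assumes "complex_space M" "linear_subspace M B"
  shows "abelian_subgroup B M"
proof -
  interpret M: complex_space M by fact
  have inv: "\<ominus>\<^bsub>M\<^esub> x = (-1) \<odot>\<^bsub>M\<^esub> x" if "x \<in> carrier M" for x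
    using M.add_smult_minus_one[OF that] that
    by (metis M.a_comm M.minus_equality M.smult_closed)
  have "subgroup B (add_monoid M)"
  proof (rule M.add.subgroupI)
    show "\<ominus>\<^bsub>M\<^esub> x \<in> B" if "x \<in> B" for x
      using that assms(2) inv[of x] by (auto simp: linear_subspace_def subset_iff)
  qed (use assms(2) in \<open>auto simp: linear_subspace_def\<close>)
  then show ?thesis
    by (intro abelian_subgroupI3 additive_subgroupI M.abelian_group)
qed

lemma coset_add:
  assumes "complex_space M" "linear_subspace M B" "x \<in> carrier M" "y \<in> carrier M"
  shows "(B +>\<^bsub>M\<^esub> x) <+>\<^bsub>M\<^esub> (B +>\<^bsub>M\<^esub> y) = B +>\<^bsub>M\<^esub> (x \<oplus>\<^bsub>M\<^esub> y)"
  by (rule abelian_subgroup.a_rcos_sum[OF linear_subspace_imp_abelian_subgroup[OF assms(1,2)] assms(3,4)])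

lemma coset_eqI:
  assumes "complex_space M" "linear_subspace M B" "y \<in> carrier M" "b \<in> B" "x = b \<oplus>\<^bsub>M\<^esub> y"
  shows "B +>\<^bsub>M\<^esub> x = B +>\<^bsub>M\<^esub> y"
proof -
  interpret complex_space M by fact
  interpret abelian_subgroup B M by (rule linear_subspace_imp_abelian_subgroup) fact+
  show ?thesis
    using a_repr_independence[OF a_rcosI[OF assms(4) a_subset assms(3)] assms(3) a_subgroup]
    unfolding assms(5) by (rule sym)
qed

lemma coset_self:
  assumes "complex_space M" "linear_subspace M B" "x \<in> carrier M"
  shows "x \<in> B +>\<^bsub>M\<^esub> x"
  by (rule abelian_subgroup.a_rcos_self[OF linear_subspace_imp_abelian_subgroup[OF assms(1,2)] assms(3)])

lemma in_coset: "y \<in> B +>\<^bsub>M\<^esub> x \<longleftrightarrow> (\<exists>b\<in>B. y = b \<oplus>\<^bsub>M\<^esub> x)"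
  by (auto simp: a_r_coset_def')

lemma coset_map_coset:
  assumes "complex_space M" "complex_space N" "linear_subspace M B" "linear_subspace N B'"
    and "linear_map M N h" "h ` B \<subseteq> B'" "x \<in> carrier M"
  shows "coset_map N B' h (B +>\<^bsub>M\<^esub> x) = B' +>\<^bsub>N\<^esub> h x"
proof -
  have "B' +>\<^bsub>N\<^esub> h z = B' +>\<^bsub>N\<^esub> h x" if z: "z \<in> B +>\<^bsub>M\<^esub> x" for z
  proof -
    obtain b where "b \<in> B" "z = b \<oplus>\<^bsub>M\<^esub> x"
      using z by (auto simp: in_coset)
    then show ?thesis
      using assms(3,5-7)
      by (intro coset_eqI[OF assms(2,4), of _ "h b"]) (auto simp: linear_map_def linear_subspace_def)
  qed
  then show ?thesis
    using coset_self[OF assms(1,3,7)] unfolding coset_map_def by blast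
qed

text \<open>
  Scaling is the induced map of a linear endomorphism, so its effect on cosets is a case of
  the previous lemma.
\<close>
lemma smult_coset:
  assumes "complex_space M" "linear_subspace M B" "x \<in> carrier M"
  shows "(\<Union>z\<in>B +>\<^bsub>M\<^esub> x. B +>\<^bsub>M\<^esub> (a \<odot>\<^bsub>M\<^esub> z)) = B +>\<^bsub>M\<^esub> (a \<odot>\<^bsub>M\<^esub> x)"
proof -
  interpret complex_space M by fact
  have comm: "a \<odot>\<^bsub>M\<^esub> (b \<odot>\<^bsub>M\<^esub> y) = b \<odot>\<^bsub>M\<^esub> (a \<odot>\<^bsub>M\<^esub> y)" if "y \<in> carrier M" for b y
    by (metis that smult_assoc mult.commute)
  have lin: "linear_map M M (\<lambda>z. a \<odot>\<^bsub>M\<^esub> z)"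
    unfolding linear_map_def by (intro conjI ballI allI funcsetI smult_r_distr comm smult_closed)
  have "(\<lambda>z. a \<odot>\<^bsub>M\<^esub> z) ` B \<subseteq> B"
    using assms(2) by (auto simp: linear_subspace_def)
  from coset_map_coset[OF assms(1,1,2,2) lin this assms(3)]
  have "coset_map M B (\<lambda>z. a \<odot>\<^bsub>M\<^esub> z) (B +>\<^bsub>M\<^esub> x) = B +>\<^bsub>M\<^esub> (a \<odot>\<^bsub>M\<^esub> x)" .
  then show ?thesis by (simp only: coset_map_def)
qed

lemma carrier_subquotient: "carrier (subquotient M Z B) = (\<lambda>z. B +>\<^bsub>M\<^esub> z) ` Z"
  by (simp add: subquotient_def)

lemma subquotient_add:
  assumes "complex_space M" "linear_subspace M B" "x \<in> carrier M" "y \<in> carrier M"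
  shows "(B +>\<^bsub>M\<^esub> x) \<oplus>\<^bsub>subquotient M Z B\<^esub> (B +>\<^bsub>M\<^esub> y) = B +>\<^bsub>M\<^esub> (x \<oplus>\<^bsub>M\<^esub> y)"
  using coset_add[OF assms] by (simp add: subquotient_def)

lemma subquotient_smult:
  assumes "complex_space M" "linear_subspace M B" "x \<in> carrier M"
  shows "a \<odot>\<^bsub>subquotient M Z B\<^esub> (B +>\<^bsub>M\<^esub> x) = B +>\<^bsub>M\<^esub> (a \<odot>\<^bsub>M\<^esub> x)"
  unfolding subquotient_def using smult_coset[OF assms] by (simp only: module.simps ring.simps)

lemma subquotient_zero:
  assumes "complex_space M" "linear_subspace M B"
  shows "\<zero>\<^bsub>subquotient M Z B\<^esub> = B +>\<^bsub>M\<^esub> \<zero>\<^bsub>M\<^esub>"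
proof -
  interpret complex_space M by fact
  show ?thesis
    using assms(2) a_coset_add_zero[of B] unfolding subquotient_def linear_subspace_def by simp
qed

lemma complex_space_subquotient:
  assumes cs: "complex_space M" and Z: "linear_subspace M Z" and B: "linear_subspace M B"
  shows "complex_space (subquotient M Z B)"
proof -
  interpret complex_space M by fact
  let ?Q = "subquotient M Z B"
  have ZM: "z \<in> carrier M" if "z \<in> Z" for z
    using Z that unfolding linear_subspace_def by blast
  have Z0: "\<zero>\<^bsub>M\<^esub> \<in> Z" and Za: "\<And>x y. x \<in> Z \<Longrightarrow> y \<in> Z \<Longrightarrow> x \<oplus>\<^bsub>M\<^esub> y \<in> Z"
    and Zs: "\<And>a x. x \<in> Z \<Longrightarrow> a \<odot>\<^bsub>M\<^esub> x \<in> Z"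
    using Z unfolding linear_subspace_def by blast+
  note simps = subquotient_add[OF cs B] subquotient_smult[OF cs B] subquotient_zero[OF cs B]
  show ?thesis
  proof (intro complex_space.intro abelian_monoidI complex_space_axioms.intro)
    fix P Q R assume "P \<in> carrier ?Q" "Q \<in> carrier ?Q" "R \<in> carrier ?Q"
    then obtain x y z where "x \<in> Z" "y \<in> Z" "z \<in> Z"
      and "P = B +>\<^bsub>M\<^esub> x" "Q = B +>\<^bsub>M\<^esub> y" "R = B +>\<^bsub>M\<^esub> z"
      unfolding carrier_subquotient by blast
    then show "P \<oplus>\<^bsub>?Q\<^esub> Q \<oplus>\<^bsub>?Q\<^esub> R = P \<oplus>\<^bsub>?Q\<^esub> (Q \<oplus>\<^bsub>?Q\<^esub> R)"
      by (simp add: simps ZM a_assoc)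
  next
    fix P Q a assume "P \<in> carrier ?Q" "Q \<in> carrier ?Q"
    then obtain x y where xy: "x \<in> Z" "y \<in> Z" "P = B +>\<^bsub>M\<^esub> x" "Q = B +>\<^bsub>M\<^esub> y"
      unfolding carrier_subquotient by blast
    then show "P \<oplus>\<^bsub>?Q\<^esub> Q = Q \<oplus>\<^bsub>?Q\<^esub> P" "a \<odot>\<^bsub>?Q\<^esub> (P \<oplus>\<^bsub>?Q\<^esub> Q) = a \<odot>\<^bsub>?Q\<^esub> P \<oplus>\<^bsub>?Q\<^esub> a \<odot>\<^bsub>?Q\<^esub> Q"
      by (simp_all add: simps ZM a_comm smult_r_distr)
    show "P \<oplus>\<^bsub>?Q\<^esub> Q \<in> carrier ?Q"
      using xy by (simp add: simps ZM Za carrier_subquotient)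
  next
    fix P a b assume "P \<in> carrier ?Q"
    then obtain x where x: "x \<in> Z" "P = B +>\<^bsub>M\<^esub> x"
      unfolding carrier_subquotient by blast
    then show "(a + b) \<odot>\<^bsub>?Q\<^esub> P = a \<odot>\<^bsub>?Q\<^esub> P \<oplus>\<^bsub>?Q\<^esub> b \<odot>\<^bsub>?Q\<^esub> P"
      "(a * b) \<odot>\<^bsub>?Q\<^esub> P = a \<odot>\<^bsub>?Q\<^esub> (b \<odot>\<^bsub>?Q\<^esub> P)" "1 \<odot>\<^bsub>?Q\<^esub> P = P"
      by (simp_all add: simps ZM smult_l_distr smult_assoc)
    show "a \<odot>\<^bsub>?Q\<^esub> P \<in> carrier ?Q"
      using x by (simp add: simps ZM Zs carrier_subquotient)
    show "0 \<odot>\<^bsub>?Q\<^esub> P = \<zero>\<^bsub>?Q\<^esub>" "\<zero>\<^bsub>?Q\<^esub> \<oplus>\<^bsub>?Q\<^esub> P = P"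
      unfolding subquotient_zero[OF cs B] x(2)
      using x by (simp_all add: subquotient_add[OF cs B] subquotient_smult[OF cs B] ZM del: a_coset_add_zero)
  qed (use Z0 subquotient_zero[OF cs B] in \<open>simp add: carrier_subquotient\<close>)
qed

lemma subquotient_finsum:
  assumes cs: "complex_space M" and Z: "linear_subspace M Z" and B: "linear_subspace M B"
    and "finite A" "y \<in> A \<rightarrow> Z"
  shows "(\<Oplus>\<^bsub>subquotient M Z B\<^esub>s\<in>A. a s \<odot>\<^bsub>subquotient M Z B\<^esub> (B +>\<^bsub>M\<^esub> y s))
           = B +>\<^bsub>M\<^esub> (\<Oplus>\<^bsub>M\<^esub>s\<in>A. a s \<odot>\<^bsub>M\<^esub> y s)"
proof -
  interpret M: complex_space M by fact
  let ?Q = "subquotient M Z B"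
  interpret Q: complex_space ?Q by (rule complex_space_subquotient) fact+
  show ?thesis using assms(4,5)
  proof (induction A rule: finite_induct)
    case empty
    then show ?case by (simp add: subquotient_zero[OF cs B])
  next
    case (insert x F)
    have y: "y s \<in> carrier M" "(B +>\<^bsub>M\<^esub> y s) \<in> carrier (subquotient M Z B)" if "s \<in> insert x F" for s
      using insert.prems Z that by (auto simp: linear_subspace_def carrier_subquotient)
    have sum: "(\<Oplus>\<^bsub>M\<^esub>s\<in>F. a s \<odot>\<^bsub>M\<^esub> y s) \<in> carrier M"
      using y by (intro M.finsum_closed) auto
    have "(\<Oplus>\<^bsub>?Q\<^esub>s\<in>insert x F. a s \<odot>\<^bsub>?Q\<^esub> (B +>\<^bsub>M\<^esub> y s))
        = a x \<odot>\<^bsub>?Q\<^esub> (B +>\<^bsub>M\<^esub> y x) \<oplus>\<^bsub>?Q\<^esub> (\<Oplus>\<^bsub>?Q\<^esub>s\<in>F. a s \<odot>\<^bsub>?Q\<^esub> (B +>\<^bsub>M\<^esub> y s))"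
      using y insert.hyps by (intro Q.finsum_insert) auto
    also have "\<dots> = (B +>\<^bsub>M\<^esub> (a x \<odot>\<^bsub>M\<^esub> y x)) \<oplus>\<^bsub>?Q\<^esub> (B +>\<^bsub>M\<^esub> (\<Oplus>\<^bsub>M\<^esub>s\<in>F. a s \<odot>\<^bsub>M\<^esub> y s))"
      using insert.IH insert.prems subquotient_smult[OF cs B y(1)] by (simp add: Pi_iff)
    also have "\<dots> = B +>\<^bsub>M\<^esub> (a x \<odot>\<^bsub>M\<^esub> y x \<oplus>\<^bsub>M\<^esub> (\<Oplus>\<^bsub>M\<^esub>s\<in>F. a s \<odot>\<^bsub>M\<^esub> y s))"
      using y sum by (intro subquotient_add[OF cs B]) auto
    also have "a x \<odot>\<^bsub>M\<^esub> y x \<oplus>\<^bsub>M\<^esub> (\<Oplus>\<^bsub>M\<^esub>s\<in>F. a s \<odot>\<^bsub>M\<^esub> y s) = (\<Oplus>\<^bsub>M\<^esub>s\<in>insert x F. a s \<odot>\<^bsub>M\<^esub> y s)"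
      using y insert.hyps by (intro M.finsum_insert[symmetric]) auto
    finally show ?case .
  qed
qed

section \<open>Dual spaces\<close>

lemma linear_functional_restrict:
  assumes "complex_space M" "linear_form M e"
  shows "restrict e (carrier M) \<in> linear_functionals M"
proof -
  interpret complex_space M by fact
  show ?thesis using assms(2) by (auto simp: linear_functionals_def linear_form_def)
qed

lemma complex_space_dual_space:
  assumes "complex_space M"
  shows "complex_space (dual_space M)"
proof -
  interpret complex_space M by fact
  show ?thesis
    by (intro complex_space.intro abelian_monoidI complex_space_axioms.intro)
      (auto simp: dual_space_def linear_functionals_def algebra_simps fun_eq_iff
        extensional_def restrict_def)
qed

definition dual_map :: "'b cvec \<Rightarrow> ('b \<Rightarrow> 'c) \<Rightarrow> ('c \<Rightarrow> complex) \<Rightarrow> 'b \<Rightarrow> complex" where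
  "dual_map M h \<phi> = (\<lambda>x\<in>carrier M. \<phi> (h x))"

lemma linear_map_dual_map:
  assumes "complex_space M" "linear_map M N h"
  shows "linear_map (dual_space N) (dual_space M) (dual_map M h)"
proof -
  interpret complex_space M by fact
  have h: "h x \<in> carrier N" if "x \<in> carrier M" for x
    using assms(2) that by (auto simp: linear_map_def)
  have "dual_map M h \<phi> \<in> linear_functionals M" if "\<phi> \<in> linear_functionals N" for \<phi>
    unfolding dual_map_def using that assms(2) h
    by (intro linear_functional_restrict[OF assms(1)])
      (auto simp: linear_functionals_def linear_form_def linear_map_def)
  then show ?thesis
    using h by (auto simp: linear_map_def dual_space_def dual_map_def fun_eq_iff)
qed

section \<open>Complex chains\<close>

text \<open>
  Chains of every degree, of a space and of its subspaces, live in one type of finitely supported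
  functions.  As a type-based vector space it gives access to bases, spans and right inverses of
  linear maps.
\<close>
abbreviation cscale :: "complex \<Rightarrow> ('k \<Rightarrow>\<^sub>0 complex) \<Rightarrow> 'k \<Rightarrow>\<^sub>0 complex" where
  "cscale a \<equiv> Poly_Mapping.map ((*) a)"

lemma lookup_cscale [simp]: "Poly_Mapping.lookup (cscale a z) f = a * Poly_Mapping.lookup z f"
  by (simp add: Poly_Mapping.map.rep_eq when_def)

lemma cscale_zero [simp]: "cscale a 0 = 0"
  by (rule poly_mapping_eqI) simp

lemma keys_cscale: "Poly_Mapping.keys (cscale a z) = (if a = 0 then {} else Poly_Mapping.keys z)"
  by (auto simp: in_keys_iff intro!: poly_mapping_eqI)

lemma vector_space_cscale: "vector_space cscale"
  by unfold_locales (auto intro!: poly_mapping_eqI simp: lookup_add algebra_simps)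

lemma vector_space_complex: "vector_space ((*) :: complex \<Rightarrow> complex \<Rightarrow> complex)"
  by unfold_locales (auto simp: algebra_simps)

lemma cscale_sum: "cscale a (sum g S) = (\<Sum>s\<in>S. cscale a (g s))"
proof -
  interpret vector_space cscale by (rule vector_space_cscale)
  show ?thesis by (rule scale_sum_right)
qed

text \<open>
  Boundaries and chain maps are given as sums over the support, and the support of a sum can be smaller
  than the union of the supports.  Additivity of \<open>G f\<close> makes a zero coefficient contribute nothing, so
  the sums can be compared over a common set of simplices.
\<close>
lemma linear_sum_keys:
  fixes G :: "'k \<Rightarrow> complex \<Rightarrow> 'l \<Rightarrow>\<^sub>0 complex"
  assumes add: "\<And>f a b. G f (a + b) = G f a + G f b" and scale: "\<And>f a b. G f (a * b) = cscale a (G f b)"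
  shows "Vector_Spaces.linear cscale cscale (\<lambda>z. \<Sum>f\<in>Poly_Mapping.keys z. G f (Poly_Mapping.lookup z f))"
proof -
  have zero: "G f 0 = 0" for f
    using add[of f 0 0] by simp
  have "(\<Sum>f\<in>Poly_Mapping.keys (cscale a z). G f (a * Poly_Mapping.lookup z f)) =
      cscale a (\<Sum>f\<in>Poly_Mapping.keys z. G f (Poly_Mapping.lookup z f))" for a z
  proof (cases "a = 0")
    case True
    then show ?thesis by (simp add: keys_cscale poly_mapping_eq_iff fun_eq_iff)
  next
    case False
    then show ?thesis by (simp add: keys_cscale cscale_sum scale)
  qed
  then show ?thesis
    unfolding Vector_Spaces.linear_iff
    by (intro conjI allI vector_space_cscale setsum_keys_plus_distrib[of G, OF zero add]) simp
qed

lemma linear_cboundary: "Vector_Spaces.linear cscale cscale (cboundary p)"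
proof (cases "p = 0")
  case True
  then show ?thesis
    unfolding Vector_Spaces.linear_iff cboundary_def by (auto simp: vector_space_cscale poly_mapping_eq_iff fun_eq_iff)
next
  case False
  define G where "G f a = (\<Sum>k\<le>p. Poly_Mapping.single (singular_face p k f) ((-1) ^ k * a))"
    for f :: "(nat \<Rightarrow> real) \<Rightarrow> 'a" and a :: complex
  have "cboundary p = (\<lambda>z. \<Sum>f\<in>Poly_Mapping.keys z. G f (Poly_Mapping.lookup z f))"
    using False by (simp add: cboundary_def G_def fun_eq_iff)
  moreover have "Vector_Spaces.linear cscale cscale \<dots>"
    by (rule linear_sum_keys)
      (simp_all add: G_def distrib_left single_add sum.distrib cscale_sum mult.left_commute)
  ultimately show ?thesis by (simp only:)
qed

lemma linear_cchain_map: "Vector_Spaces.linear cscale cscale (cchain_map p g)"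
  unfolding cchain_map_def by (rule linear_sum_keys) (simp_all add: single_add)

text \<open>
  The coefficient inclusion of integral chains.  It commutes with boundaries and with induced maps,
  and every single simplex with coefficient 1 is in its range; so identities between linear maps on
  complex chains follow from the corresponding identities for integral chains.
\<close>
definition complexify :: "('k \<Rightarrow>\<^sub>0 int) \<Rightarrow> 'k \<Rightarrow>\<^sub>0 complex" where
  "complexify = Poly_Mapping.map of_int"

lemma lookup_complexify [simp]: "Poly_Mapping.lookup (complexify c) f = of_int (Poly_Mapping.lookup c f)"
  by (simp add: complexify_def Poly_Mapping.map.rep_eq when_def)

lemma keys_complexify [simp]: "Poly_Mapping.keys (complexify c) = Poly_Mapping.keys c"
  by (auto simp: in_keys_iff)

lemma complexify_sum: "complexify (sum g S) = (\<Sum>s\<in>S. complexify (g s))"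
  by (rule poly_mapping_eqI) (simp add: lookup_sum)

lemma complexify_zero [simp]: "complexify 0 = 0"
  by (rule poly_mapping_eqI) simp

lemma complexify_frag_cmul: "complexify (frag_cmul a c) = cscale (of_int a) (complexify c)"
  by (rule poly_mapping_eqI) simp

lemma complexify_single: "complexify (Poly_Mapping.single f a) = Poly_Mapping.single f (of_int a)"
  by (simp add: complexify_def)

lemma cboundary_complexify: "cboundary p (complexify c) = complexify (chain_boundary p c)"
  by (auto simp: cboundary_def chain_boundary_def frag_extend_def complexify_sum complexify_frag_cmul
      complexify_single cscale_sum lookup_sum lookup_single when_def intro!: poly_mapping_eqI sum.cong)

lemma cchain_map_complexify: "cchain_map p g (complexify c) = complexify (chain_map p g c)"
  by (simp add: cchain_map_def chain_map_def frag_extend_def complexify_sum complexify_frag_cmul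
      complexify_single)

lemma linear_eq_on_complexified_simplices:
  assumes "Vector_Spaces.linear cscale cscale h" "Vector_Spaces.linear cscale cscale h'"
    and "\<And>f. f \<in> Poly_Mapping.keys z \<Longrightarrow> h (complexify (frag_of f)) = h' (complexify (frag_of f))"
  shows "h z = h' z"
proof -
  interpret vector_space_pair cscale cscale
    by (simp add: vector_space_pair_def vector_space_cscale)
  have z: "z = (\<Sum>f\<in>Poly_Mapping.keys z. cscale (Poly_Mapping.lookup z f) (complexify (frag_of f)))"
    by (rule poly_mapping_eqI) (simp add: lookup_sum complexify_single lookup_single when_def in_keys_iff)
  show ?thesis
    by (subst (1 2) z) (use assms in \<open>simp add: linear_sum linear_scale\<close>)
qed

lemma carrier_cchains [simp]: "z \<in> carrier (cchains p X) \<longleftrightarrow> Poly_Mapping.keys z \<subseteq> singular_simplex_set p X"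
  and zero_cchains [simp]: "\<zero>\<^bsub>cchains p X\<^esub> = 0"
  and add_cchains [simp]: "z \<oplus>\<^bsub>cchains p X\<^esub> w = z + w"
  and smult_cchains [simp]: "a \<odot>\<^bsub>cchains p X\<^esub> z = cscale a z"
  by (simp_all add: cchains_def)

lemma complex_space_cchains: "complex_space (cchains p X)"
proof -
  interpret vector_space cscale by (rule vector_space_cscale)
  show ?thesis
    by (intro complex_space.intro abelian_monoidI complex_space_axioms.intro)
      (auto simp: keys_cscale add_ac scale_left_distrib scale_right_distrib dest: keys_add[THEN subsetD])
qed

lemma linear_map_cchains:
  assumes "Vector_Spaces.linear cscale cscale h"
    and "\<And>z. z \<in> carrier (cchains p X) \<Longrightarrow> h z \<in> carrier (cchains q Y)"
  shows "linear_map (cchains p X) (cchains q Y) h"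
  using assms by (auto simp: linear_map_def Vector_Spaces.linear_iff)

lemma cboundary_cboundary:
  fixes z :: "'a cchain"
  assumes "z \<in> carrier (cchains (Suc p) X)"
  shows "cboundary p (cboundary (Suc p) z) = 0"
proof -
  define h :: "'a cchain \<Rightarrow> 'a cchain" where "h = cboundary p \<circ> cboundary (Suc p)"
  define h' :: "'a cchain \<Rightarrow> 'a cchain" where "h' = (\<lambda>_. 0)"
  have lin: "Vector_Spaces.linear cscale cscale h"
    unfolding h_def by (rule Vector_Spaces.linear_compose[OF linear_cboundary linear_cboundary])
  have lin': "Vector_Spaces.linear cscale cscale h'"
    by (auto simp: h'_def Vector_Spaces.linear_iff vector_space_cscale poly_mapping_eq_iff fun_eq_iff)
  have "h (complexify (frag_of f)) = h' (complexify (frag_of f))" if "f \<in> Poly_Mapping.keys z" for f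
  proof -
    have "singular_chain (Suc p) X (frag_of f)"
      using that assms by (auto simp: singular_chain_def)
    then show ?thesis
      by (simp add: h_def h'_def cboundary_complexify chain_boundary_boundary_alt)
  qed
  from linear_eq_on_complexified_simplices[OF lin lin' this] show ?thesis
    by (simp add: h_def h'_def)
qed

lemma cboundary_cchain_map:
  fixes z :: "'a cchain" and g :: "'a \<Rightarrow> 'b"
  assumes "z \<in> carrier (cchains p X)"
  shows "cboundary p (cchain_map p g z) = cchain_map (p - 1) g (cboundary p z)"
proof -
  define h :: "'a cchain \<Rightarrow> 'b cchain" where "h = cboundary p \<circ> cchain_map p g"
  define h' :: "'a cchain \<Rightarrow> 'b cchain" where "h' = cchain_map (p - 1) g \<circ> cboundary p"
  have lin: "Vector_Spaces.linear cscale cscale h"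
    unfolding h_def by (rule Vector_Spaces.linear_compose[OF linear_cchain_map linear_cboundary])
  have lin': "Vector_Spaces.linear cscale cscale h'"
    unfolding h'_def by (rule Vector_Spaces.linear_compose[OF linear_cboundary linear_cchain_map])
  have "h (complexify (frag_of f)) = h' (complexify (frag_of f))" if "f \<in> Poly_Mapping.keys z" for f
  proof -
    have "singular_chain p X (frag_of f)"
      using that assms by (auto simp: singular_chain_def)
    from chain_boundary_chain_map[OF this, of g] show ?thesis
      by (simp only: h_def h'_def cboundary_complexify cchain_map_complexify comp_apply One_nat_def)
  qed
  from linear_eq_on_complexified_simplices[OF lin lin' this] show ?thesis
    by (simp add: h_def h'_def)
qed

lemma linear_map_cboundary: "linear_map (cchains p X) (cchains (p - 1) X) (cboundary p)"
proof (rule linear_map_cchains[OF linear_cboundary])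
  fix z assume z: "z \<in> carrier (cchains p X)"
  have "singular_simplex (p - 1) X (singular_face p k f)" if "p \<noteq> 0" "k \<le> p" "f \<in> Poly_Mapping.keys z" for k f
    using that z singular_simplex_singular_face[of p X f k] by auto
  then show "cboundary p z \<in> carrier (cchains (p - 1) X)"
    by (fastforce simp: cboundary_def split: if_splits dest!: keys_sum[THEN subsetD])
qed

lemma linear_map_cchain_map:
  assumes "continuous_map X Y g"
  shows "linear_map (cchains p X) (cchains p Y) (cchain_map p g)"
proof (rule linear_map_cchains[OF linear_cchain_map])
  fix z assume z: "z \<in> carrier (cchains p X)"
  then have "singular_simplex p Y (simplex_map p g f)" if "f \<in> Poly_Mapping.keys z" for f
    using that assms by (auto intro: singular_simplex_simplex_map)
  then show "cchain_map p g z \<in> carrier (cchains p Y)"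
    by (fastforce simp: cchain_map_def split: if_splits dest!: keys_sum[THEN subsetD])
qed

section \<open>Homology and cohomology as vector spaces\<close>

lemma linear_subspace_ccycles: "linear_subspace (cchains p X) (ccycles p X)"
  using linear_subspace_kernel[OF complex_space_cchains complex_space_cchains linear_map_cboundary[of p X]]
  by (simp add: ccycles_def)

lemma linear_subspace_cboundaries: "linear_subspace (cchains p X) (cboundaries p X)"
  using linear_subspace_image[OF complex_space_cchains complex_space_cchains linear_map_cboundary[of "Suc p" X]]
  by (simp add: cboundaries_def)

lemma cboundaries_subset_ccycles: "cboundaries p X \<subseteq> ccycles p X"
  using linear_subspace_cboundaries[of p X] cboundary_cboundary[of _ p X]
  unfolding cboundaries_def ccycles_def linear_subspace_def by blast

lemma complex_space_chomology: "complex_space (chomology p X)"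
  unfolding chomology_def
  by (rule complex_space_subquotient[OF complex_space_cchains linear_subspace_ccycles linear_subspace_cboundaries])

lemma complex_space_ccochains: "complex_space (ccochains p X)"
  unfolding ccochains_def by (rule complex_space_dual_space[OF complex_space_cchains])

lemma linear_map_ccoboundary: "linear_map (ccochains p X) (ccochains (Suc p) X) (ccoboundary p X)"
  using linear_map_dual_map[OF complex_space_cchains linear_map_cboundary[of "Suc p" X]]
  by (simp add: ccochains_def ccoboundary_def[abs_def] dual_map_def[abs_def])

lemma linear_map_ccochain_map:
  assumes "continuous_map X Y g"
  shows "linear_map (ccochains p Y) (ccochains p X) (ccochain_map p X g)"
  using linear_map_dual_map[OF complex_space_cchains linear_map_cchain_map[OF assms, of p]]
  by (simp add: ccochains_def ccochain_map_def[abs_def] dual_map_def[abs_def])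

lemma linear_subspace_ccocycles: "linear_subspace (ccochains p X) (ccocycles p X)"
  using linear_subspace_kernel[OF complex_space_ccochains complex_space_ccochains linear_map_ccoboundary[of p X]]
  by (simp add: ccocycles_def)

lemma linear_subspace_ccoboundaries: "linear_subspace (ccochains p X) (ccoboundaries p X)"
proof (cases p)
  case 0
  interpret complex_space "ccochains 0 X" by (rule complex_space_ccochains)
  show ?thesis using 0 by (simp add: ccoboundaries_def linear_subspace_def)
next
  case (Suc q)
  then show ?thesis
    using linear_subspace_image[OF complex_space_ccochains complex_space_ccochains linear_map_ccoboundary[of q X]]
    by (simp add: ccoboundaries_def)
qed

lemma complex_space_ccohomology: "complex_space (ccohomology p X)"
  unfolding ccohomology_def
  by (rule complex_space_subquotient[OF complex_space_ccochains linear_subspace_ccocycles linear_subspace_ccoboundaries])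

lemma chomologyE:
  assumes "\<xi> \<in> carrier (chomology p X)"
  obtains z where "z \<in> ccycles p X" "\<xi> = cboundaries p X +>\<^bsub>cchains p X\<^esub> z"
  using assms by (auto simp: chomology_def carrier_subquotient)

lemma ccohomologyE:
  assumes "\<alpha> \<in> carrier (ccohomology p X)"
  obtains \<phi> where "\<phi> \<in> ccocycles p X" "\<alpha> = ccoboundaries p X +>\<^bsub>ccochains p X\<^esub> \<phi>"
  using assms by (auto simp: ccohomology_def carrier_subquotient)

lemma ccochain_add:
  "\<phi> \<in> carrier (ccochains p X) \<Longrightarrow> z \<in> carrier (cchains p X) \<Longrightarrow> w \<in> carrier (cchains p X) \<Longrightarrow> \<phi> (z + w) = \<phi> z + \<phi> w"
  and ccochain_smult:
  "\<phi> \<in> carrier (ccochains p X) \<Longrightarrow> z \<in> carrier (cchains p X) \<Longrightarrow> \<phi> (cscale a z) = a * \<phi> z"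
  by (simp_all add: ccochains_def dual_space_def linear_functionals_def)

lemma ccochains_apply:
  assumes "z \<in> carrier (cchains p X)"
  shows "(\<phi> \<oplus>\<^bsub>ccochains p X\<^esub> \<psi>) z = \<phi> z + \<psi> z" "(a \<odot>\<^bsub>ccochains p X\<^esub> \<phi>) z = a * \<phi> z"
  using assms by (simp_all add: ccochains_def dual_space_def)

lemma ccochains_eqI:
  assumes "\<phi> \<in> carrier (ccochains p X)" "\<psi> \<in> carrier (ccochains p X)"
    and "\<And>z. z \<in> carrier (cchains p X) \<Longrightarrow> \<phi> z = \<psi> z"
  shows "\<phi> = \<psi>"
  by (rule extensionalityI[where A = "carrier (cchains p X)"])
    (use assms in \<open>auto simp: ccochains_def dual_space_def linear_functionals_def\<close>)

lemma ccochain_restrict: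
  assumes "\<And>z w. z \<in> carrier (cchains p X) \<Longrightarrow> w \<in> carrier (cchains p X) \<Longrightarrow> e (z + w) = e z + e w"
    and "\<And>a z. z \<in> carrier (cchains p X) \<Longrightarrow> e (cscale a z) = a * e z"
  shows "restrict e (carrier (cchains p X)) \<in> carrier (ccochains p X)"
  using linear_functional_restrict[OF complex_space_cchains, of p X e] assms
  by (simp add: ccochains_def dual_space_def linear_form_def)

lemma ccocycles_iff:
  "\<phi> \<in> ccocycles p X \<longleftrightarrow>
     \<phi> \<in> carrier (ccochains p X) \<and> (\<forall>z \<in> carrier (cchains (Suc p) X). \<phi> (cboundary (Suc p) z) = 0)"
  by (auto simp: ccocycles_def ccoboundary_def ccochains_def dual_space_def fun_eq_iff restrict_def)

section \<open>The evaluation pairing\<close>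

lemma ccocycle_on_cboundary:
  assumes "\<phi> \<in> ccocycles p X" "w \<in> cboundaries p X"
  shows "\<phi> w = 0"
  using assms by (auto simp: ccocycles_iff cboundaries_def)

lemma ccoboundary_on_ccycle:
  assumes "b \<in> ccoboundaries p X" "z \<in> ccycles p X"
  shows "b z = 0"
proof (cases p)
  case 0
  then show ?thesis
    using assms by (simp add: ccoboundaries_def ccochains_def dual_space_def ccycles_def)
next
  case (Suc q)
  then obtain \<psi> where \<psi>: "\<psi> \<in> carrier (ccochains q X)" "b = ccoboundary q X \<psi>"
    using assms(1) by (auto simp: ccoboundaries_def)
  have "\<psi> 0 = 0"
    using ccochain_smult[OF \<psi>(1), of 0 0] by simp
  then show ?thesis
    using assms(2) \<psi>(2) Suc by (simp add: ccycles_def ccoboundary_def)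
qed

text \<open>
  Changing the cocycle by a coboundary or the cycle by a boundary leaves the value alone.  The
  changed cycle is again a cycle because the boundary of a boundary vanishes, so that the coboundary
  is evaluated on a cycle.
\<close>
lemma kronecker_coset:
  assumes \<phi>: "\<phi> \<in> ccocycles p X" and z: "z \<in> ccycles p X"
  shows "kronecker (ccoboundaries p X +>\<^bsub>ccochains p X\<^esub> \<phi>) (cboundaries p X +>\<^bsub>cchains p X\<^esub> z) = \<phi> z"
proof -
  have \<phi>C: "\<phi> \<in> carrier (ccochains p X)" and zC: "z \<in> carrier (cchains p X)"
    using \<phi> z by (auto simp: ccocycles_iff ccycles_def)
  have eq: "\<phi>' z' = \<phi> z"
    if \<phi>': "\<phi>' \<in> ccoboundaries p X +>\<^bsub>ccochains p X\<^esub> \<phi>" and z': "z' \<in> cboundaries p X +>\<^bsub>cchains p X\<^esub> z"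
    for \<phi>' z'
  proof -
    obtain b w where b: "b \<in> ccoboundaries p X" "\<phi>' = b \<oplus>\<^bsub>ccochains p X\<^esub> \<phi>"
      and w: "w \<in> cboundaries p X" "z' = w + z"
      using \<phi>' z' unfolding in_coset by auto
    have wZ: "w \<in> ccycles p X" and wC: "w \<in> carrier (cchains p X)"
      using w(1) cboundaries_subset_ccycles by (auto simp: ccycles_def)
    have z'Z: "z' \<in> ccycles p X"
      using linear_subspace_ccycles[of p X] wZ z w(2) unfolding linear_subspace_def by auto
    then have "z' \<in> carrier (cchains p X)"
      unfolding ccycles_def by blast
    then have "\<phi>' z' = b z' + \<phi> z'"
      unfolding b(2) by (rule ccochains_apply)
    also have "\<dots> = \<phi> w + \<phi> z"
      unfolding ccoboundary_on_ccycle[OF b(1) z'Z] unfolding w(2) ccochain_add[OF \<phi>C wC zC] by simp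
    finally show ?thesis
      using ccocycle_on_cboundary[OF \<phi> w(1)] by simp
  qed
  show ?thesis
    unfolding kronecker_def
  proof (rule the_equality)
    show "\<exists>\<phi>'\<in>ccoboundaries p X +>\<^bsub>ccochains p X\<^esub> \<phi>. \<exists>z'\<in>cboundaries p X +>\<^bsub>cchains p X\<^esub> z. \<phi> z = \<phi>' z'"
      using coset_self[OF complex_space_ccochains linear_subspace_ccoboundaries \<phi>C]
        coset_self[OF complex_space_cchains linear_subspace_cboundaries zC] by blast
  qed (use eq in blast)
qed

lemma linear_form_kronecker:
  assumes "\<alpha> \<in> carrier (ccohomology p X)"
  shows "linear_form (chomology p X) (kronecker \<alpha>)"
proof -
  note cs = complex_space_cchains linear_subspace_cboundaries
  obtain \<phi> where \<phi>: "\<phi> \<in> ccocycles p X" and \<alpha>: "\<alpha> = ccoboundaries p X +>\<^bsub>ccochains p X\<^esub> \<phi>"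
    using assms by (rule ccohomologyE)
  have \<phi>C: "\<phi> \<in> carrier (ccochains p X)" and ZC: "\<And>z. z \<in> ccycles p X \<Longrightarrow> z \<in> carrier (cchains p X)"
    using \<phi> unfolding ccocycles_iff ccycles_def by blast+
  have Z: "z + w \<in> ccycles p X" "cscale a z \<in> ccycles p X" if "z \<in> ccycles p X" "w \<in> ccycles p X" for z w a
    using linear_subspace_ccycles[of p X] that unfolding linear_subspace_def by auto
  show ?thesis
    unfolding linear_form_def
  proof (intro conjI ballI allI)
    fix \<xi> \<eta> assume "\<xi> \<in> carrier (chomology p X)" "\<eta> \<in> carrier (chomology p X)"
    then obtain z w where zw: "z \<in> ccycles p X" "w \<in> ccycles p X"
      and eq: "\<xi> = cboundaries p X +>\<^bsub>cchains p X\<^esub> z" "\<eta> = cboundaries p X +>\<^bsub>cchains p X\<^esub> w"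
      by (metis chomologyE)
    have "\<xi> \<oplus>\<^bsub>chomology p X\<^esub> \<eta> = cboundaries p X +>\<^bsub>cchains p X\<^esub> (z + w)"
      using subquotient_add[OF cs ZC[OF zw(1)] ZC[OF zw(2)]] by (simp add: chomology_def eq)
    then show "kronecker \<alpha> (\<xi> \<oplus>\<^bsub>chomology p X\<^esub> \<eta>) = kronecker \<alpha> \<xi> + kronecker \<alpha> \<eta>"
      using zw by (simp add: \<alpha> eq kronecker_coset \<phi> Z ccochain_add[OF \<phi>C ZC ZC])
  next
    fix a \<xi> assume "\<xi> \<in> carrier (chomology p X)"
    then obtain z where z: "z \<in> ccycles p X" and eq: "\<xi> = cboundaries p X +>\<^bsub>cchains p X\<^esub> z"
      by (metis chomologyE)
    have "a \<odot>\<^bsub>chomology p X\<^esub> \<xi> = cboundaries p X +>\<^bsub>cchains p X\<^esub> (cscale a z)"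
      using subquotient_smult[OF cs ZC[OF z]] by (simp add: chomology_def eq)
    then show "kronecker \<alpha> (a \<odot>\<^bsub>chomology p X\<^esub> \<xi>) = a * kronecker \<alpha> \<xi>"
      using z by (simp add: \<alpha> eq kronecker_coset \<phi> Z ccochain_smult[OF \<phi>C ZC])
  qed
qed

lemma linear_form_kronecker_left:
  assumes "\<xi> \<in> carrier (chomology p X)"
  shows "linear_form (ccohomology p X) (\<lambda>\<alpha>. kronecker \<alpha> \<xi>)"
proof -
  note cs = complex_space_ccochains linear_subspace_ccoboundaries
  obtain z where z: "z \<in> ccycles p X" and \<xi>: "\<xi> = cboundaries p X +>\<^bsub>cchains p X\<^esub> z"
    using assms by (rule chomologyE)
  have zC: "z \<in> carrier (cchains p X)" and ZC: "\<And>\<phi>. \<phi> \<in> ccocycles p X \<Longrightarrow> \<phi> \<in> carrier (ccochains p X)"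
    using z unfolding ccocycles_iff ccycles_def by blast+
  have Z: "\<phi> \<oplus>\<^bsub>ccochains p X\<^esub> \<psi> \<in> ccocycles p X" "a \<odot>\<^bsub>ccochains p X\<^esub> \<phi> \<in> ccocycles p X"
    if "\<phi> \<in> ccocycles p X" "\<psi> \<in> ccocycles p X" for \<phi> \<psi> a
    using linear_subspace_ccocycles[of p X] that unfolding linear_subspace_def by auto
  show ?thesis
    unfolding linear_form_def
  proof (intro conjI ballI allI)
    fix \<alpha> \<beta> assume "\<alpha> \<in> carrier (ccohomology p X)" "\<beta> \<in> carrier (ccohomology p X)"
    then obtain \<phi> \<psi> where \<phi>: "\<phi> \<in> ccocycles p X" "\<psi> \<in> ccocycles p X"
      and eq: "\<alpha> = ccoboundaries p X +>\<^bsub>ccochains p X\<^esub> \<phi>" "\<beta> = ccoboundaries p X +>\<^bsub>ccochains p X\<^esub> \<psi>"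
      by (metis ccohomologyE)
    have "\<alpha> \<oplus>\<^bsub>ccohomology p X\<^esub> \<beta> = ccoboundaries p X +>\<^bsub>ccochains p X\<^esub> (\<phi> \<oplus>\<^bsub>ccochains p X\<^esub> \<psi>)"
      using subquotient_add[OF cs ZC[OF \<phi>(1)] ZC[OF \<phi>(2)]] by (simp add: ccohomology_def eq)
    then show "kronecker (\<alpha> \<oplus>\<^bsub>ccohomology p X\<^esub> \<beta>) \<xi> = kronecker \<alpha> \<xi> + kronecker \<beta> \<xi>"
      using \<phi> by (simp add: \<xi> eq kronecker_coset z Z ccochains_apply[OF zC])
  next
    fix a \<alpha> assume "\<alpha> \<in> carrier (ccohomology p X)"
    then obtain \<phi> where \<phi>: "\<phi> \<in> ccocycles p X" and eq: "\<alpha> = ccoboundaries p X +>\<^bsub>ccochains p X\<^esub> \<phi>"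
      by (metis ccohomologyE)
    have "a \<odot>\<^bsub>ccohomology p X\<^esub> \<alpha> = ccoboundaries p X +>\<^bsub>ccochains p X\<^esub> (a \<odot>\<^bsub>ccochains p X\<^esub> \<phi>)"
      using subquotient_smult[OF cs ZC[OF \<phi>]] by (simp add: ccohomology_def eq)
    then show "kronecker (a \<odot>\<^bsub>ccohomology p X\<^esub> \<alpha>) \<xi> = a * kronecker \<alpha> \<xi>"
      using \<phi> by (simp add: \<xi> eq kronecker_coset z Z ccochains_apply[OF zC])
  qed
qed

lemma chain_subspace:
  assumes "linear_subspace (cchains p X) S"
  shows "module.subspace cscale S"
proof -
  interpret vector_space cscale by (rule vector_space_cscale)
  show ?thesis using assms by (auto simp: linear_subspace_def subspace_def)
qed

section \<open>Universal coefficients over the complex numbers\<close>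

text \<open>
  Injectivity in the universal coefficient theorem.  Over a field the boundary \<open>C\<^sub>p \<rightarrow> C\<^bsub>p-1\<^esub>\<close> has a
  linear right inverse \<open>g\<close> on its image.  If \<open>\<phi> - \<psi>\<close> vanishes on cycles, then it vanishes on
  \<open>z - g (\<partial>z)\<close>, hence \<open>(\<phi> - \<psi>) z = ((\<phi> - \<psi>) \<circ> g) (\<partial>z)\<close>, which exhibits it as the coboundary of
  \<open>(\<phi> - \<psi>) \<circ> g\<close>.
\<close>
lemma ccohomology_eqI:
  assumes "\<alpha> \<in> carrier (ccohomology p X)" "\<beta> \<in> carrier (ccohomology p X)"
    and eq: "\<And>\<xi>. \<xi> \<in> carrier (chomology p X) \<Longrightarrow> kronecker \<alpha> \<xi> = kronecker \<beta> \<xi>"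
  shows "\<alpha> = \<beta>"
proof -
  obtain \<phi> \<psi> where \<phi>: "\<phi> \<in> ccocycles p X" and \<psi>: "\<psi> \<in> ccocycles p X"
    and \<alpha>: "\<alpha> = ccoboundaries p X +>\<^bsub>ccochains p X\<^esub> \<phi>" and \<beta>: "\<beta> = ccoboundaries p X +>\<^bsub>ccochains p X\<^esub> \<psi>"
    using assms(1,2) by (metis ccohomologyE)
  have \<phi>C: "\<phi> \<in> carrier (ccochains p X)" and \<psi>C: "\<psi> \<in> carrier (ccochains p X)"
    using \<phi> \<psi> by (simp_all add: ccocycles_iff)
  have cycle_eq: "\<phi> z = \<psi> z" if "z \<in> ccycles p X" for z
  proof -
    have "cboundaries p X +>\<^bsub>cchains p X\<^esub> z \<in> carrier (chomology p X)"
      using that by (auto simp: chomology_def carrier_subquotient)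
    from eq[OF this] show ?thesis
      by (simp add: \<alpha> \<beta> kronecker_coset \<phi> \<psi> that)
  qed
  have "\<exists>b\<in>ccoboundaries p X. \<phi> = b \<oplus>\<^bsub>ccochains p X\<^esub> \<psi>"
  proof (cases p)
    case 0
    \<comment> \<open>In degree 0 every chain is a cycle, and only the zero cochain is a coboundary.\<close>
    have "\<phi> = \<psi>"
      by (rule ccochains_eqI[OF \<phi>C \<psi>C]) (use 0 cycle_eq in \<open>simp add: ccycles_def cboundary_def\<close>)
    moreover interpret complex_space "ccochains p X" by (rule complex_space_ccochains)
    have "\<psi> = \<zero>\<^bsub>ccochains p X\<^esub> \<oplus>\<^bsub>ccochains p X\<^esub> \<psi>"
      using \<psi>C by simp
    ultimately show ?thesis
      using linear_subspace_ccoboundaries[of p X] unfolding linear_subspace_def by blast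
  next
    case (Suc q)
    interpret vector_space_pair cscale cscale
      by (simp add: vector_space_pair_def vector_space_cscale)
    let ?C = "carrier (cchains p X)"
    have "vs1.subspace ?C"
      by (rule chain_subspace[OF linear_subspace_carrier[OF complex_space_cchains]])
    \<comment> \<open>The values of \<open>g\<close> must lie in \<open>C\<^sub>p(X)\<close>, the only place where \<open>\<phi>\<close> and \<open>\<psi>\<close> are linear.\<close>
    from linear_exists_right_inverse_on[OF linear_cboundary this, of p]
    obtain g where g: "range g \<subseteq> ?C" "Vector_Spaces.linear cscale cscale g"
      and dg: "\<And>z. z \<in> ?C \<Longrightarrow> cboundary p (g (cboundary p z)) = cboundary p z"
      by auto
    have gC: "g w \<in> ?C" for w
      using g(1) by blast
    define e where "e w = \<phi> (g w) - \<psi> (g w)" for w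
    let ?b = "restrict e (carrier (cchains q X))"
    have b: "?b \<in> carrier (ccochains q X)"
    proof (rule ccochain_restrict)
      show "e (z + w) = e z + e w" for z w
        using g(2) by (simp add: e_def Vector_Spaces.linear_iff ccochain_add[OF \<phi>C gC gC] ccochain_add[OF \<psi>C gC gC])
      show "e (cscale a z) = a * e z" for a z
        using g(2) by (simp add: e_def Vector_Spaces.linear_iff ccochain_smult[OF \<phi>C gC] ccochain_smult[OF \<psi>C gC]
          right_diff_distrib)
    qed
    have \<delta>b: "ccoboundary q X ?b \<in> ccoboundaries p X"
      using b Suc by (simp add: ccoboundaries_def)
    have "\<phi> = ccoboundary q X ?b \<oplus>\<^bsub>ccochains p X\<^esub> \<psi>"
    proof (rule ccochains_eqI[OF \<phi>C])
      interpret K: complex_space "ccochains p X" by (rule complex_space_ccochains)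
      show "ccoboundary q X ?b \<oplus>\<^bsub>ccochains p X\<^esub> \<psi> \<in> carrier (ccochains p X)"
        using \<delta>b linear_subspace_ccoboundaries[of p X] \<psi>C unfolding linear_subspace_def by auto
      fix z assume z: "z \<in> ?C"
      have dz: "cboundary p z \<in> carrier (cchains q X)"
        using funcset_mem[OF linear_map_cboundary[of p X, unfolded linear_map_def, THEN conjunct1] z] Suc
        by simp
      \<comment> \<open>the cycle \<open>z - g (\<partial>z)\<close>\<close>
      let ?r = "z + cscale (-1) (g (cboundary p z))"
      have rC: "?r \<in> ?C"
      proof -
        interpret C: complex_space "cchains p X" by (rule complex_space_cchains)
        have "z \<oplus>\<^bsub>cchains p X\<^esub> (-1) \<odot>\<^bsub>cchains p X\<^esub> g (cboundary p z) \<in> ?C"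
          by (intro C.a_closed C.smult_closed z gC)
        then show ?thesis unfolding add_cchains smult_cchains .
      qed
      have "cboundary p ?r = cboundary p z + cscale (-1) (cboundary p (g (cboundary p z)))"
        using linear_cboundary[of p] unfolding Vector_Spaces.linear_iff by metis
      then have "cboundary p ?r = 0"
        using dg[OF z] by simp
      then have "\<phi> ?r = \<psi> ?r"
        using rC cycle_eq unfolding ccycles_def by blast
      moreover have eval: "\<theta> ?r = \<theta> z - \<theta> (g (cboundary p z))" if "\<theta> \<in> carrier (ccochains p X)" for \<theta>
        using ccochain_add[OF that z complex_space.smult_closed[OF complex_space_cchains gC], of "-1"]
          ccochain_smult[OF that gC[of "cboundary p z"], of "-1"] by simp
      ultimately have "\<phi> z - \<phi> (g (cboundary p z)) = \<psi> z - \<psi> (g (cboundary p z))"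
        unfolding eval[OF \<phi>C] eval[OF \<psi>C] by blast
      then have "\<phi> z = e (cboundary p z) + \<psi> z"
        by (simp add: e_def algebra_simps)
      also have "\<dots> = (ccoboundary q X ?b \<oplus>\<^bsub>ccochains p X\<^esub> \<psi>) z"
        unfolding ccochains_apply(1)[OF z] using z dz Suc by (simp add: ccoboundary_def)
      finally show "\<phi> z = (ccoboundary q X ?b \<oplus>\<^bsub>ccochains p X\<^esub> \<psi>) z" .
    qed
    then show ?thesis using \<delta>b by blast
  qed
  then obtain b where "b \<in> ccoboundaries p X" "\<phi> = b \<oplus>\<^bsub>ccochains p X\<^esub> \<psi>" by blast
  then show ?thesis
    unfolding \<alpha> \<beta> by (rule coset_eqI[OF complex_space_ccochains linear_subspace_ccoboundaries \<psi>C])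
qed

text \<open>
  A basis of \<open>S\<close> together with \<open>y\<close> is linearly independent, so the values on it can be chosen.
\<close>
lemma exists_linear_form_separating:
  assumes "module.subspace cscale S" "y \<notin> S"
  shows "\<exists>f. Vector_Spaces.linear cscale ((*) :: complex \<Rightarrow> complex \<Rightarrow> complex) f \<and> (\<forall>x\<in>S. f x = 0) \<and> f y = 1"
proof -
  interpret vector_space_pair cscale "(*) :: complex \<Rightarrow> complex \<Rightarrow> complex"
    by (simp add: vector_space_pair_def vector_space_cscale vector_space_complex)
  obtain B where B: "B \<subseteq> S" "vs1.independent B" "S \<subseteq> vs1.span B"
    by (rule vs1.maximal_independent_subset)
  have yB: "y \<notin> vs1.span B"
    using vs1.span_minimal[OF B(1) assms(1)] assms(2) by blast
  have ind: "vs1.independent (insert y B)"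
    by (rule vs1.independent_insertI[OF yB B(2)])
  define f where "f = construct (insert y B) (\<lambda>x. if x = y then 1 else 0)"
  have lin: "Vector_Spaces.linear cscale (*) f"
    unfolding f_def by (rule linear_construct[OF ind])
  have fb: "f b = (if b = y then 1 else 0)" if "b \<in> insert y B" for b
    unfolding f_def by (rule construct_basis[OF ind that])
  have "f b = 0" if "b \<in> B" for b
    using fb[of b] that yB vs1.span_base[of y B] by auto
  then have "f x = 0" if "x \<in> vs1.span B" for x
    using linear_eq_0_on_span[OF lin _ that] by blast
  moreover have "f y = 1" using fb[of y] by simp
  ultimately show ?thesis
    using lin B(3) by blast
qed

lemma finsum_cchains:
  assumes "finite A" "h \<in> A \<rightarrow> carrier (cchains p X)"
  shows "(\<Oplus>\<^bsub>cchains p X\<^esub>s\<in>A. h s) = (\<Sum>s\<in>A. h s)"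
proof -
  interpret C: complex_space "cchains p X" by (rule complex_space_cchains)
  show ?thesis using assms
  proof (induction A rule: finite_induct)
    case (insert x F)
    then have h: "h \<in> F \<rightarrow> carrier (cchains p X)" "h x \<in> carrier (cchains p X)"
      by blast+
    from C.finsum_insert[OF insert.hyps h] show ?case
      using insert.IH[OF h(1)] insert.hyps by simp
  qed simp
qed

text \<open>
  Linear independence of the classes \<open>y s\<close> at the level of chains: a relation expressing \<open>r k\<close> by
  boundaries and the other representatives would be a relation between the classes with coefficient
  \<open>-1\<close> at \<open>k\<close>.  This is what allows a functional on chains to be prescribed below.
\<close>
lemma representative_notin_span:
  assumes y: "y \<in> K \<rightarrow> carrier (chomology p X)"
    and ind: "linear_independent_family (chomology p X) K y" and k: "k \<in> K"
    and r: "\<And>s. s \<in> K \<Longrightarrow> r s \<in> ccycles p X"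
    and yr: "\<And>s. s \<in> K \<Longrightarrow> y s = cboundaries p X +>\<^bsub>cchains p X\<^esub> r s"
  shows "r k \<notin> module.span cscale (cboundaries p X \<union> r ` (K - {k}))"
proof
  interpret vector_space cscale by (rule vector_space_cscale)
  interpret C: complex_space "cchains p X" by (rule complex_space_cchains)
  have sub: "subspace (cboundaries p X)"
    by (rule chain_subspace[OF linear_subspace_cboundaries])
  assume "r k \<in> span (cboundaries p X \<union> r ` (K - {k}))"
  then obtain b v where b: "b \<in> cboundaries p X" and v: "v \<in> span (r ` (K - {k}))" and rk: "r k = b + v"
    using span_eq_iff sub unfolding span_Un by blast
  obtain t c where t: "finite t" "t \<subseteq> r ` (K - {k})" and vt: "v = (\<Sum>u\<in>t. cscale (c u) u)"
    using v unfolding span_explicit by blast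
  obtain A where A: "A \<subseteq> K - {k}" "finite A" "inj_on r A" "t = r ` A"
    using t unfolding subset_image_inj by (metis finite_imageD)
  have vA: "v = (\<Sum>s\<in>A. cscale (c (r s)) (r s))"
    unfolding vt A(4) by (simp add: sum.reindex[OF A(3)])
  define a where "a s = (if s = k then -1 else c (r s))" for s
  have kA: "k \<notin> A" and AK: "insert k A \<subseteq> K" and fin: "finite (insert k A)"
    using A k by auto
  have rA: "r \<in> insert k A \<rightarrow> ccycles p X"
    using r AK by blast
  have "(\<Oplus>\<^bsub>chomology p X\<^esub>s\<in>insert k A. a s \<odot>\<^bsub>chomology p X\<^esub> y s)
      = (\<Oplus>\<^bsub>chomology p X\<^esub>s\<in>insert k A. a s \<odot>\<^bsub>chomology p X\<^esub> (cboundaries p X +>\<^bsub>cchains p X\<^esub> r s))"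
  proof -
    interpret H: complex_space "chomology p X" by (rule complex_space_chomology)
    have "cboundaries p X +>\<^bsub>cchains p X\<^esub> r s \<in> carrier (chomology p X)" if "s \<in> insert k A" for s
      using funcset_mem[OF y, of s] yr[of s] AK that by auto
    then show ?thesis
      by (intro H.finsum_cong'[OF refl] funcsetI H.smult_closed) (use yr AK in auto)
  qed
  also have "\<dots> = cboundaries p X +>\<^bsub>cchains p X\<^esub> (\<Oplus>\<^bsub>cchains p X\<^esub>s\<in>insert k A. a s \<odot>\<^bsub>cchains p X\<^esub> r s)"
    unfolding chomology_def
    by (rule subquotient_finsum[OF complex_space_cchains linear_subspace_ccycles linear_subspace_cboundaries fin rA])
  also have "(\<Oplus>\<^bsub>cchains p X\<^esub>s\<in>insert k A. a s \<odot>\<^bsub>cchains p X\<^esub> r s) = (\<Sum>s\<in>insert k A. cscale (a s) (r s))"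
  proof -
    have "r s \<in> carrier (cchains p X)" if "s \<in> insert k A" for s
      using rA that unfolding ccycles_def by blast
    then have "(\<lambda>s. a s \<odot>\<^bsub>cchains p X\<^esub> r s) \<in> insert k A \<rightarrow> carrier (cchains p X)"
      by (intro funcsetI C.smult_closed)
    from finsum_cchains[OF fin this] show ?thesis by simp
  qed
  also have "\<dots> = - r k + v"
  proof -
    have "(\<Sum>s\<in>A. cscale (a s) (r s)) = v"
      unfolding vA by (rule sum.cong) (use kA in \<open>auto simp: a_def\<close>)
    then show ?thesis using kA A(2) by (simp add: a_def)
  qed
  also have "\<dots> = - b"
    using rk by simp
  also have "cboundaries p X +>\<^bsub>cchains p X\<^esub> (- b) = cboundaries p X +>\<^bsub>cchains p X\<^esub> \<zero>\<^bsub>cchains p X\<^esub>"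
    by (rule coset_eqI[OF complex_space_cchains linear_subspace_cboundaries C.zero_closed subspace_neg[OF sub b]]) simp
  also have "\<dots> = \<zero>\<^bsub>chomology p X\<^esub>"
    unfolding chomology_def
    by (rule subquotient_zero[OF complex_space_cchains linear_subspace_cboundaries, symmetric])
  finally have "a k = 0"
    using ind fin AK unfolding linear_independent_family_def by blast
  then show False by (simp add: a_def)
qed

text \<open>
  Surjectivity in the universal coefficient theorem, for the coordinate functionals.  A functional on
  chains that kills the boundaries is a cocycle; one that also kills the representatives of the
  other \<open>y s\<close> and takes the value 1 on that of \<open>y k\<close> represents the dual class.  Working with chains
  avoids having to define the functional first on homology and then extend it.
\<close>
lemma exists_dual_cohomology_class:
  assumes y: "y \<in> K \<rightarrow> carrier (chomology p X)"
    and ind: "linear_independent_family (chomology p X) K y" and k: "k \<in> K"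
  shows "\<exists>\<alpha>\<in>carrier (ccohomology p X). \<forall>k'\<in>K. kronecker \<alpha> (y k') = (if k = k' then 1 else 0)"
proof -
  interpret vector_space cscale by (rule vector_space_cscale)
  have "\<forall>s\<in>K. \<exists>z. z \<in> ccycles p X \<and> y s = cboundaries p X +>\<^bsub>cchains p X\<^esub> z"
    using y by (metis chomologyE funcset_mem)
  then obtain r where r: "\<And>s. s \<in> K \<Longrightarrow> r s \<in> ccycles p X"
    and yr: "\<And>s. s \<in> K \<Longrightarrow> y s = cboundaries p X +>\<^bsub>cchains p X\<^esub> r s"
    by metis
  let ?T = "cboundaries p X \<union> r ` (K - {k})"
  obtain f where f: "Vector_Spaces.linear cscale ((*) :: complex \<Rightarrow> complex \<Rightarrow> complex) f"
    and f0: "\<And>x. x \<in> span ?T \<Longrightarrow> f x = 0" and fk: "f (r k) = 1"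
    using exists_linear_form_separating[OF subspace_span representative_notin_span[OF assms r yr]] by blast
  let ?\<phi> = "restrict f (carrier (cchains p X))"
  have \<phi>C: "?\<phi> \<in> carrier (ccochains p X)"
    using f by (intro ccochain_restrict) (auto simp: Vector_Spaces.linear_iff)
  have "?\<phi> w = 0" if w: "w \<in> cboundaries p X" for w
  proof -
    have "w \<in> carrier (cchains p X)"
      using w linear_subspace_cboundaries[of p X] unfolding linear_subspace_def by blast
    then show ?thesis
      using w f0[OF span_base, of w] by (simp only: restrict_apply' Un_iff simp_thms)
  qed
  then have \<phi>: "?\<phi> \<in> ccocycles p X"
    using \<phi>C by (auto simp: ccocycles_iff cboundaries_def)
  let ?\<alpha> = "ccoboundaries p X +>\<^bsub>ccochains p X\<^esub> ?\<phi>"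
  have "kronecker ?\<alpha> (y k') = (if k = k' then 1 else 0)" if k': "k' \<in> K" for k'
  proof -
    have "kronecker ?\<alpha> (y k') = ?\<phi> (r k')"
      unfolding yr[OF k'] by (rule kronecker_coset[OF \<phi> r[OF k']])
    also have "\<dots> = f (r k')"
      using r[OF k'] unfolding ccycles_def by auto
    also have "\<dots> = (if k = k' then 1 else 0)"
      using fk f0[OF span_base, of "r k'"] k' by auto
    finally show ?thesis .
  qed
  moreover have "?\<alpha> \<in> carrier (ccohomology p X)"
    using \<phi> by (simp add: ccohomology_def carrier_subquotient)
  ultimately show ?thesis by blast
qed

text \<open>
  The description in the definition picks out exactly one class: uniqueness is the injectivity
  above, as two such classes agree on a spanning family of the homology.
\<close>
lemma dual_class_well_defined:
  assumes basis: "basis_family (chomology p X) K y" and k: "k \<in> K"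
  shows "dual_class p X K y k \<in> carrier (ccohomology p X)"
    and "k' \<in> K \<Longrightarrow> kronecker (dual_class p X K y k) (y k') = (if k = k' then 1 else 0)"
proof -
  let ?P = "\<lambda>\<alpha>. \<alpha> \<in> carrier (ccohomology p X) \<and> (\<forall>k'\<in>K. kronecker \<alpha> (y k') = (if k = k' then 1 else 0))"
  have "\<alpha> = \<beta>" if "?P \<alpha>" "?P \<beta>" for \<alpha> \<beta>
  proof (rule ccohomology_eqI)
    show "kronecker \<alpha> \<xi> = kronecker \<beta> \<xi>" if "\<xi> \<in> carrier (chomology p X)" for \<xi>
      by (rule linear_form_eq_on_spanning_family[OF complex_space_chomology _ _ basis _ that])
        (use \<open>?P \<alpha>\<close> \<open>?P \<beta>\<close> in \<open>auto intro: linear_form_kronecker\<close>)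
  qed (use that in auto)
  moreover have "\<exists>\<alpha>. ?P \<alpha>"
    using exists_dual_cohomology_class[OF _ _ k] basis unfolding basis_family_def by blast
  ultimately have "\<exists>!\<alpha>. ?P \<alpha>" by blast
  from theI'[OF this] show "dual_class p X K y k \<in> carrier (ccohomology p X)"
    and "k' \<in> K \<Longrightarrow> kronecker (dual_class p X K y k) (y k') = (if k = k' then 1 else 0)"
    by (simp_all add: dual_class_def)
qed

section \<open>Naturality of the pairing\<close>

context
  fixes X :: "'a topology" and Y :: "'b topology" and g :: "'a \<Rightarrow> 'b"
  assumes g: "continuous_map X Y g"
begin

lemma cchain_map_closed: "z \<in> carrier (cchains p X) \<Longrightarrow> cchain_map p g z \<in> carrier (cchains p Y)"
  using linear_map_cchain_map[OF g, of p] unfolding linear_map_def by blast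

lemma cboundary_closed: "z \<in> carrier (cchains (Suc p) X) \<Longrightarrow> cboundary (Suc p) z \<in> carrier (cchains p X)"
  using linear_map_cboundary[of "Suc p" X] unfolding linear_map_def diff_Suc_1 by blast

lemma cchain_map_cboundaries: "cchain_map p g ` cboundaries p X \<subseteq> cboundaries p Y"
proof clarify
  fix w assume "w \<in> cboundaries p X"
  then obtain z where z: "z \<in> carrier (cchains (Suc p) X)" "w = cboundary (Suc p) z"
    by (auto simp: cboundaries_def)
  have "cchain_map p g w = cboundary (Suc p) (cchain_map (Suc p) g z)"
    using cboundary_cchain_map[OF z(1), of g] z(2) by simp
  then show "cchain_map p g w \<in> cboundaries p Y"
    using cchain_map_closed[OF z(1)] unfolding cboundaries_def by blast
qed

lemma cchain_map_ccycles:
  assumes "z \<in> ccycles p X"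
  shows "cchain_map p g z \<in> ccycles p Y"
proof -
  have z: "z \<in> carrier (cchains p X)" "cboundary p z = 0"
    using assms unfolding ccycles_def by blast+
  have "cchain_map (p - 1) g 0 = 0"
    by (simp add: cchain_map_def)
  then show ?thesis
    using cchain_map_closed[OF z(1)] cboundary_cchain_map[OF z(1), of g] z(2)
    unfolding ccycles_def by simp
qed

lemma ccochain_map_ccoboundaries: "ccochain_map p X g ` ccoboundaries p Y \<subseteq> ccoboundaries p X"
proof (cases p)
  case 0
  then show ?thesis
    using linear_map_zero[OF complex_space_ccochains complex_space_ccochains linear_map_ccochain_map[OF g, of p]]
    by (simp add: ccoboundaries_def)
next
  case (Suc q)
  have "ccochain_map (Suc q) X g (ccoboundary q Y \<psi>) = ccoboundary q X (ccochain_map q X g \<psi>)" for \<psi>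
    unfolding ccochain_map_def ccoboundary_def
  proof (rule restrict_ext)
    fix z assume z: "z \<in> carrier (cchains (Suc q) X)"
    show "(\<lambda>z\<in>carrier (cchains (Suc q) Y). \<psi> (cboundary (Suc q) z)) (cchain_map (Suc q) g z)
        = (\<lambda>z\<in>carrier (cchains q X). \<psi> (cchain_map q g z)) (cboundary (Suc q) z)"
      unfolding restrict_apply'[OF cchain_map_closed[OF z]] restrict_apply'[OF cboundary_closed[OF z]]
      using cboundary_cchain_map[OF z, of g] by simp
  qed
  moreover have "ccochain_map q X g \<psi> \<in> carrier (ccochains q X)" if "\<psi> \<in> carrier (ccochains q Y)" for \<psi>
    using linear_map_ccochain_map[OF g, of q] that unfolding linear_map_def by blast
  ultimately show ?thesis
    using Suc by (auto simp: ccoboundaries_def)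
qed

lemma ccochain_map_ccocycles:
  assumes "\<phi> \<in> ccocycles p Y"
  shows "ccochain_map p X g \<phi> \<in> ccocycles p X"
proof -
  have \<phi>: "\<phi> \<in> carrier (ccochains p Y)" using assms by (simp add: ccocycles_iff)
  have "ccochain_map p X g \<phi> (cboundary (Suc p) z) = 0" if z: "z \<in> carrier (cchains (Suc p) X)" for z
  proof -
    have "ccochain_map p X g \<phi> (cboundary (Suc p) z) = \<phi> (cboundary (Suc p) (cchain_map (Suc p) g z))"
      unfolding ccochain_map_def restrict_apply'[OF cboundary_closed[OF z]]
      using cboundary_cchain_map[OF z, of g] by simp
    then show ?thesis
      using assms cchain_map_closed[OF z] unfolding ccocycles_iff by simp
  qed
  moreover have "ccochain_map p X g \<phi> \<in> carrier (ccochains p X)"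
    using linear_map_ccochain_map[OF g, of p] \<phi> unfolding linear_map_def by blast
  ultimately show ?thesis by (simp add: ccocycles_iff)
qed

lemma chomology_map_coset:
  assumes "z \<in> ccycles p X"
  shows "chomology_map p Y g (cboundaries p X +>\<^bsub>cchains p X\<^esub> z) = cboundaries p Y +>\<^bsub>cchains p Y\<^esub> cchain_map p g z"
  unfolding chomology_map_def
  by (rule coset_map_coset[OF complex_space_cchains complex_space_cchains linear_subspace_cboundaries
        linear_subspace_cboundaries linear_map_cchain_map[OF g] cchain_map_cboundaries])
    (use assms in \<open>simp add: ccycles_def\<close>)

lemma ccohomology_map_coset:
  assumes "\<phi> \<in> ccocycles p Y"
  shows "ccohomology_map p X g (ccoboundaries p Y +>\<^bsub>ccochains p Y\<^esub> \<phi>)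
           = ccoboundaries p X +>\<^bsub>ccochains p X\<^esub> ccochain_map p X g \<phi>"
  unfolding ccohomology_map_def
  by (rule coset_map_coset[OF complex_space_ccochains complex_space_ccochains linear_subspace_ccoboundaries
        linear_subspace_ccoboundaries linear_map_ccochain_map[OF g] ccochain_map_ccoboundaries])
    (use assms in \<open>simp add: ccocycles_iff\<close>)

lemma ccohomology_map_closed:
  assumes "\<alpha> \<in> carrier (ccohomology p Y)"
  shows "ccohomology_map p X g \<alpha> \<in> carrier (ccohomology p X)"
proof -
  obtain \<phi> where \<phi>: "\<phi> \<in> ccocycles p Y" "\<alpha> = ccoboundaries p Y +>\<^bsub>ccochains p Y\<^esub> \<phi>"
    using assms by (rule ccohomologyE)
  then show ?thesis
    using ccochain_map_ccocycles by (simp add: ccohomology_map_coset ccohomology_def carrier_subquotient)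
qed

lemma ccohomology_map_zero: "ccohomology_map p X g \<zero>\<^bsub>ccohomology p Y\<^esub> = \<zero>\<^bsub>ccohomology p X\<^esub>"
proof -
  have "\<zero>\<^bsub>ccochains p Y\<^esub> \<in> ccocycles p Y"
    using linear_subspace_ccocycles[of p Y] unfolding linear_subspace_def by blast
  from ccohomology_map_coset[OF this] show ?thesis
    unfolding ccohomology_def subquotient_zero[OF complex_space_ccochains linear_subspace_ccoboundaries]
      linear_map_zero[OF complex_space_ccochains complex_space_ccochains linear_map_ccochain_map[OF g]] .
qed

text \<open>
  The projection formula \<open>\<langle>g\<^sup>* \<alpha>, \<xi>\<rangle> = \<langle>\<alpha>, g\<^sub>* \<xi>\<rangle>\<close>.  On representatives it is the definition of the
  pullback of a cochain.
\<close>
lemma kronecker_natural: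
  assumes "\<alpha> \<in> carrier (ccohomology p Y)" "\<xi> \<in> carrier (chomology p X)"
  shows "kronecker (ccohomology_map p X g \<alpha>) \<xi> = kronecker \<alpha> (chomology_map p Y g \<xi>)"
proof -
  obtain \<phi> where \<phi>: "\<phi> \<in> ccocycles p Y" and \<alpha>: "\<alpha> = ccoboundaries p Y +>\<^bsub>ccochains p Y\<^esub> \<phi>"
    using assms(1) by (rule ccohomologyE)
  obtain z where z: "z \<in> ccycles p X" and \<xi>: "\<xi> = cboundaries p X +>\<^bsub>cchains p X\<^esub> z"
    using assms(2) by (rule chomologyE)
  have "kronecker (ccohomology_map p X g \<alpha>) \<xi> = ccochain_map p X g \<phi> z"
    unfolding \<alpha> \<xi> ccohomology_map_coset[OF \<phi>] by (rule kronecker_coset[OF ccochain_map_ccocycles[OF \<phi>] z])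
  also have "\<dots> = \<phi> (cchain_map p g z)"
    using z unfolding ccochain_map_def ccycles_def by simp
  also have "\<dots> = kronecker \<alpha> (chomology_map p Y g \<xi>)"
    unfolding \<alpha> \<xi> chomology_map_coset[OF z] by (rule kronecker_coset[OF \<phi> cchain_map_ccycles[OF z], symmetric])
  finally show ?thesis .
qed

lemma total_ccohomology_map_direct_sum_inj:
  "total_ccohomology_map X g (direct_sum_inj (\<lambda>i. ccohomology i Y) i \<alpha>)
     = direct_sum_inj (\<lambda>i. ccohomology i X) i (ccohomology_map i X g \<alpha>)"
  by (auto simp: total_ccohomology_map_def direct_sum_inj_def ccohomology_map_zero fun_eq_iff)

end

section \<open>Pullbacks of dual classes\<close>

theorem proposition7p3:
  fixes Y :: "'a topology" and X :: "'a set"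
    and J :: "nat \<Rightarrow> 'j set" and K I :: "nat \<Rightarrow> 'k set"
    and XX :: "nat \<Rightarrow> 'j \<Rightarrow> 'a cchain set" and YY :: "nat \<Rightarrow> 'k \<Rightarrow> 'a cchain set"
    and c :: "nat \<Rightarrow> 'j \<Rightarrow> 'k \<Rightarrow> complex"
  assumes "X \<subseteq> topspace Y"
    and "\<And>i::int. odd i \<Longrightarrow> trivial_group (homology_group i (subtopology Y X))"
    and "\<And>i::int. odd i \<Longrightarrow> trivial_group (homology_group i Y)"
    and "\<And>i. basis_family (chomology i (subtopology Y X)) (J i) (XX i)"
    and "\<And>i. basis_family (chomology i Y) (K i) (YY i)"
    and "\<And>i j. j \<in> J i \<Longrightarrow> finite {k \<in> K i. c i j k \<noteq> 0}"
    and "\<And>i j. j \<in> J i \<Longrightarrow>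
           chomology_map i Y id (XX i j) =
             (\<Oplus>\<^bsub>chomology i Y\<^esub>k\<in>{k \<in> K i. c i j k \<noteq> 0}. c i j k \<odot>\<^bsub>chomology i Y\<^esub> YY i k)"
    and "\<And>i. I i \<subseteq> K i"
    and "\<And>i. invertible_matrix_on (J i) (I i) (c i)"
  shows "basis_family (total_ccohomology (subtopology Y X)) (SIGMA i:UNIV. I i)
           (\<lambda>(i, k). total_ccohomology_map (subtopology Y X) id
              (direct_sum_inj (\<lambda>i. ccohomology i Y) i (dual_class i Y (K i) (YY i) k)))"
proof -
  let ?X = "subtopology Y X" and ?d = "\<lambda>i. dual_class i Y (K i) (YY i)"
  have id: "continuous_map ?X Y id"
    by (simp add: continuous_map_from_subtopology)
  have "basis_family (ccohomology i ?X) (I i) (\<lambda>k. ccohomology_map i ?X id (?d i k))" for i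
  proof (rule basis_family_if_invertible_pairing[where J = "J i" and c = "c i"
        and e = "\<lambda>j \<alpha>. kronecker \<alpha> (XX i j)"])
    have XXC: "XX i j \<in> carrier (chomology i ?X)" if "j \<in> J i" for j
      using assms(4)[of i] that unfolding basis_family_def by blast
    have d: "?d i k \<in> carrier (ccohomology i Y)" if "k \<in> I i" for k
      using dual_class_well_defined(1)[OF assms(5)] assms(8) that by blast
    show "complex_space (ccohomology i ?X)"
      by (rule complex_space_ccohomology)
    show "(\<lambda>k. ccohomology_map i ?X id (?d i k)) \<in> I i \<rightarrow> carrier (ccohomology i ?X)"
      using ccohomology_map_closed[OF id d] by blast
    show "linear_form (ccohomology i ?X) (\<lambda>\<alpha>. kronecker \<alpha> (XX i j))" if "j \<in> J i" for j
      by (rule linear_form_kronecker_left[OF XXC[OF that]])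
    show "\<alpha> = \<beta>"
      if \<alpha>\<beta>: "\<alpha> \<in> carrier (ccohomology i ?X)" "\<beta> \<in> carrier (ccohomology i ?X)"
        and eq: "\<And>j. j \<in> J i \<Longrightarrow> kronecker \<alpha> (XX i j) = kronecker \<beta> (XX i j)" for \<alpha> \<beta>
      using linear_form_eq_on_spanning_family[OF complex_space_chomology linear_form_kronecker[OF \<alpha>\<beta>(1)]
          linear_form_kronecker[OF \<alpha>\<beta>(2)] assms(4) eq]
      by (intro ccohomology_eqI[OF \<alpha>\<beta>])
    show "kronecker (ccohomology_map i ?X id (?d i k)) (XX i j) = c i j k" if j: "j \<in> J i" and k: "k \<in> I i" for j k
    proof -
      let ?S = "{k \<in> K i. c i j k \<noteq> 0}"
      have kK: "k \<in> K i" using assms(8) k by blast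
      have YYC: "YY i \<in> ?S \<rightarrow> carrier (chomology i Y)"
        using assms(5)[of i] unfolding basis_family_def by blast
      have "kronecker (ccohomology_map i ?X id (?d i k)) (XX i j)
          = kronecker (?d i k) (\<Oplus>\<^bsub>chomology i Y\<^esub>k\<in>?S. c i j k \<odot>\<^bsub>chomology i Y\<^esub> YY i k)"
        unfolding kronecker_natural[OF id d[OF k] XXC[OF j]] assms(7)[OF j] ..
      also have "\<dots> = (\<Sum>k'\<in>?S. c i j k' * kronecker (?d i k) (YY i k'))"
        by (rule linear_form_finsum[OF complex_space_chomology linear_form_kronecker[OF d[OF k]] assms(6)[OF j] YYC])
      also have "\<dots> = (\<Sum>k'\<in>?S. if k = k' then c i j k' else 0)"
        by (rule sum.cong) (auto simp: dual_class_well_defined(2)[OF assms(5) kK])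
      \<comment> \<open>If \<open>k \<notin> ?S\<close>, then the sum has no term for \<open>k\<close>, and both sides are 0.\<close>
      also have "\<dots> = c i j k"
        using assms(6)[OF j] kK by simp
      finally show ?thesis .
    qed
    show "invertible_matrix_on (J i) (I i) (c i)" by (rule assms(9))
  qed
  from basis_family_direct_sum[of "\<lambda>i. ccohomology i ?X", OF complex_space_ccohomology this]
  show ?thesis
    by (simp add: total_ccohomology_def total_ccohomology_map_direct_sum_inj[OF id])
qed

end
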